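(* Let $n\ge3$ and let $\Omega\subset\mathbb{R}^n$ be an open set. Then the conditions $r_{\Omega,\gamma}<\infty$, taken for different $\gamma\in(0,1)$, are equivalent; that is, for all $\gamma_1,\gamma_2\in(0,1)$, $r_{\Omega,\gamma_1}<\infty$ if and only if $r_{\Omega,\gamma_2}<\infty$.
   Context: $B_r$ denotes an open ball of radius $r>0$ in $\mathbb{R}^n$ (with arbitrary center) and $\bar B_r$ its closure. The Wiener capacity of a compact set $F\subset\mathbb{R}^n$ is $$\mathrm{cap}(F)=\inf\left\{\int_{\mathbb{R}^n}|\nabla u|^2dx \;:\; u:\mathbb{R}^n\to\mathbb{R}\text{ Lipschitz with compact support},\ u|_F=1\right\}.$$ For $\gamma\in(0,1)$, a compact set $F\subset\bar B_r$ is called $\gamma$-negligible (in $\bar B_r$) if $\mathrm{cap}(F)\le\gamma\,\mathrm{cap}(\bar B_r)$. The interior capacitary radius of an open set $\Omega\subset\mathbb{R}^n$ is $$r_{\Omega,\gamma}=\sup\{r>0 : \text{there is a ball } B_r \text{ such that } \bar B_r\setminus\Omega \text{ is } \gamma\text{-negligible in }\bar B_r\}\in[0,\infty]$$ (the supremum of the empty set being $0$). *)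

theory Defs
  imports "HOL-Analysis.Analysis"
begin

text \<open>
  A Lipschitz function has all its partial derivatives outside a Lebesgue null set.
  Where the partial derivative does not exist, \<^const>\<open>deriv\<close> is a fixed unspecified
  number; this does not affect the integrals below.
\<close>

definition gradient :: "(real ^ 'n \<Rightarrow> real) \<Rightarrow> real ^ 'n \<Rightarrow> real ^ 'n" where
  "gradient u x = (\<chi> i. deriv (\<lambda>t. u (x + t *\<^sub>R axis i 1)) 0)"

definition cap_admissible :: "(real ^ 'n) set \<Rightarrow> (real ^ 'n \<Rightarrow> real) set" where
  "cap_admissible F = {u. (\<exists>L. L-lipschitz_on UNIV u)
                        \<and> compact (closure {x. u x \<noteq> 0})
                        \<and> (\<forall>x\<in>F. u x = 1)}"

definition wiener_cap :: "(real ^ 'n) set \<Rightarrow> ennreal" where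
  "wiener_cap F =
     (INF u \<in> cap_admissible F. \<integral>\<^sup>+ x. ennreal ((norm (gradient u x))\<^sup>2) \<partial>lborel)"

text \<open>For \<open>r > 0\<close>, the closure of \<open>ball a r\<close> is \<open>cball a r\<close>.\<close>

definition cap_negligible :: "real \<Rightarrow> real ^ 'n \<Rightarrow> real \<Rightarrow> (real ^ 'n) set \<Rightarrow> bool" where
  "cap_negligible \<gamma> a r F \<longleftrightarrow>
     compact F \<and> F \<subseteq> cball a r \<and> wiener_cap F \<le> ennreal \<gamma> * wiener_cap (cball a r)"

text \<open>In \<^typ>\<open>ennreal\<close> the supremum of the empty set is \<open>0\<close>.\<close>

definition interior_cap_radius :: "(real ^ 'n) set \<Rightarrow> real \<Rightarrow> ennreal" where
  "interior_cap_radius \<Omega> \<gamma> =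
     Sup {ennreal r | r. 0 < r \<and> (\<exists>a. cap_negligible \<gamma> a r (cball a r - \<Omega>))}"

end

theory Submission
  imports Defs
begin

text \<open>
  If the radius for \<open>\<gamma>\<^sub>1\<close> is finite, there are \<open>r\<close> and \<open>\<kappa> > 0\<close> such that the complement of \<open>\<Omega>\<close> has
  capacity at least \<open>\<kappa>\<close> in every closed ball of radius \<open>r\<close>. Let \<open>F\<close> be the part of the complement in a
  ball of radius \<open>R\<close> much larger than \<open>r\<close>, and \<open>u\<close> a test function for \<open>F\<close> with energy \<open>E\<close>. Testing the
  capacity in the ball of radius \<open>r\<close> about \<open>a\<close> with a cutoff of \<open>(u - u a) / (1 - u a)\<close> and integrating
  over \<open>a\<close>, where the shift by \<open>h\<close> moves \<open>u\<close> by at most \<open>C |h| E\<^bsup>1/2\<^esup>\<close> in \<open>L\<^sup>2\<close>, bounds the integral of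
  \<open>(1 - u)\<^sup>2\<close> over a slightly smaller ball by \<open>C E\<close> with \<open>C\<close> independent of \<open>R\<close>. Raising \<open>u\<close> to \<open>1\<close>
  on the ball of radius \<open>\<theta> R\<close> by a cutoff with gradient of order \<open>1/R\<close> therefore costs only a factor
  \<open>1 + \<epsilon> + O(R\<^sup>-\<^sup>2)\<close>, so that
  \<open>\<theta>\<^bsup>n-2\<^esup> cap (B\<^sub>R) = cap (B\<^bsub>\<theta>R\<^esub>) \<le> (1 + \<epsilon> + O(R\<^sup>-\<^sup>2)) cap F\<close>. With \<open>\<theta>\<close> close to \<open>1\<close> and
  \<open>\<epsilon>\<close> small, \<open>cap F \<le> \<gamma>\<^sub>2 cap (B\<^sub>R)\<close> is impossible for large \<open>R\<close>.
\<close>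

section \<open>Almost everywhere differentiability of Lipschitz functions\<close>

text \<open>
  Intervals straddling the point, rather than intervals with the point as an end, make both sets
  in the intersection open.
\<close>

definition derivate_gap :: "('a::real_normed_vector \<Rightarrow> real) \<Rightarrow> 'a \<Rightarrow> real \<Rightarrow> real \<Rightarrow> 'a set" where
  "derivate_gap u e p q = (\<Inter>k::nat.
     {x. \<exists>a b. a < 0 \<and> 0 < b \<and> b - a < 1 / Suc k \<and> u (x + b *\<^sub>R e) - u (x + a *\<^sub>R e) < p * (b - a)} \<inter>
     {x. \<exists>a b. a < 0 \<and> 0 < b \<and> b - a < 1 / Suc k \<and> u (x + b *\<^sub>R e) - u (x + a *\<^sub>R e) > q * (b - a)})"

lemma derivate_gap_borel:
  fixes u :: "'a::real_normed_vector \<Rightarrow> real"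
  assumes "continuous_on UNIV u"
  shows "derivate_gap u e p q \<in> sets borel"
proof -
  have c: "continuous_on UNIV (\<lambda>x. u (x + b *\<^sub>R e) - u (x + a *\<^sub>R e))" for a b
    by (intro continuous_intros continuous_on_compose2[OF assms]) auto
  have "open {x. u (x + b *\<^sub>R e) - u (x + a *\<^sub>R e) < p * (b - a)}"
       "open {x. u (x + b *\<^sub>R e) - u (x + a *\<^sub>R e) > q * (b - a)}" for a b
    by (intro open_Collect_less c continuous_intros)+
  then have "open {x. \<exists>a b. a < 0 \<and> 0 < b \<and> b - a < 1 / Suc k \<and> u (x + b *\<^sub>R e) - u (x + a *\<^sub>R e) < p * (b - a)}"
     "open {x. \<exists>a b. a < 0 \<and> 0 < b \<and> b - a < 1 / Suc k \<and> u (x + b *\<^sub>R e) - u (x + a *\<^sub>R e) > q * (b - a)}" for k :: nat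
    by (intro open_Collect_ex open_Collect_conj open_Collect_const; simp)+
  then show ?thesis
    unfolding derivate_gap_def by (intro sets.countable_INT') (auto intro!: sets.Int borel_open)
qed

text \<open>Vitali's theorem for closed balls on the line, with the interval \<open>{a..b}\<close>
  read as the ball about its midpoint. The exceptional set is stated for the open intervals, so that
  their union can serve as the open set of a second covering.\<close>

lemma Vitali_covering_Icc:
  fixes E U :: "real set"
  assumes "open U" "E \<subseteq> U"
    and fine: "\<And>x d. x \<in> E \<Longrightarrow> 0 < d \<Longrightarrow> \<exists>a b. a < x \<and> x < b \<and> b - a < d \<and> P a b"
  obtains C where "countable C" "\<And>a b. (a, b) \<in> C \<Longrightarrow> a < b \<and> P a b \<and> {a..b} \<subseteq> U"
    "disjoint_family_on (\<lambda>(a, b). {a..b}) C"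
    "negligible (E - (\<Union>(a, b)\<in>C. {a<..<b}))"
proof -
  define K where "K = {(a, b). a < b \<and> P a b \<and> {a..b} \<subseteq> U}"
  have cb: "cball ((a + b) / 2) ((b - a) / 2) = {a..b}" for a b :: real
    by (simp add: cball_eq_atLeastAtMost field_simps)
  obtain C where C: "countable C" "C \<subseteq> K"
     "pairwise (\<lambda>i j. disjnt (cball ((fst i + snd i) / 2) ((snd i - fst i) / 2)) (cball ((fst j + snd j) / 2) ((snd j - fst j) / 2))) C"
     "negligible(E - (\<Union>i \<in> C. cball ((fst i + snd i) / 2) ((snd i - fst i) / 2)))"
  proof (rule Vitali_covering_theorem_cballs[of K "\<lambda>i. (snd i - fst i) / 2" E "\<lambda>i. (fst i + snd i) / 2"])
    show "0 < (snd i - fst i) / 2" if "i \<in> K" for i using that by (auto simp: K_def)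
    fix x d :: real assume x: "x \<in> E" "0 < d"
    obtain \<delta> where d: "\<delta> > 0" "ball x \<delta> \<subseteq> U"
      using x assms by (metis open_contains_ball subsetD)
    obtain a b where ab: "a < x" "x < b" "b - a < min \<delta> d" "P a b"
      using fine[OF x(1), of "min \<delta> d"] d x by auto
    have "{a..b} \<subseteq> ball x \<delta>" using ab by (auto simp: dist_real_def)
    then show "\<exists>i. i \<in> K \<and> x \<in> cball ((fst i + snd i) / 2) ((snd i - fst i) / 2) \<and> (snd i - fst i) / 2 < d"
      using ab d by (intro exI[of _ "(a, b)"]) (auto simp: K_def cb)
  qed auto
  show thesis
  proof
    show "countable C" by fact
    show "a < b \<and> P a b \<and> {a..b} \<subseteq> U" if "(a, b) \<in> C" for a b using that C by (auto simp: K_def)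
    show "disjoint_family_on (\<lambda>(a, b). {a..b}) C"
      using C(3) unfolding cb disjoint_family_on_def pairwise_def disjnt_def by (auto simp: split_beta)
    \<comment> \<open>Passing from closed to open intervals loses only the endpoints, and these are
      countably many.\<close>
    have "negligible (\<Union>i\<in>C. {fst i, snd i})"
      using C(1) by (intro negligible_countable_Union) auto
    then have "negligible ((E - (\<Union>i \<in> C. {fst i..snd i})) \<union> (\<Union>i\<in>C. {fst i, snd i}))"
      using C(4) unfolding cb by (rule negligible_Un[rotated])
    then show "negligible (E - (\<Union>(a, b)\<in>C. {a<..<b}))"
    proof (rule negligible_subset)
      show "E - (\<Union>(a, b)\<in>C. {a<..<b}) \<subseteq> (E - (\<Union>i \<in> C. {fst i..snd i})) \<union> (\<Union>i\<in>C. {fst i, snd i})"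
      proof
        fix x assume x: "x \<in> E - (\<Union>(a, b)\<in>C. {a<..<b})"
        show "x \<in> (E - (\<Union>i \<in> C. {fst i..snd i})) \<union> (\<Union>i\<in>C. {fst i, snd i})"
        proof (cases "x \<in> (\<Union>i \<in> C. {fst i..snd i})")
          case True
          then obtain i where i: "i \<in> C" "x \<in> {fst i..snd i}" by blast
          then have "x \<notin> {fst i<..<snd i}" using x by (auto simp: split_beta)
          with i have "x \<in> {fst i, snd i}" by auto
          with i show ?thesis by blast
        qed (use x in blast)
      qed
    qed
  qed
qed

text \<open>Lebesgue's argument. Cover a part \<open>E\<close> of the gap set by short intervals of
  slope below \<open>p\<close> inside an open set barely larger than \<open>E\<close>, then cover
  almost all of \<open>E\<close> again, inside the first cover, by intervals of slope above
  \<open>q\<close>. Monotonicity makes the total increment over the second cover at most that over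
  the first, so \<open>q\<close> times the measure of \<open>E\<close> is at most about
  \<open>p\<close> times it.\<close>

lemma null_sets_derivate_gap_mono:
  fixes g :: "real \<Rightarrow> real"
  assumes mono: "\<And>x y. x \<le> y \<Longrightarrow> g x \<le> g y" and cont: "continuous_on UNIV g"
    and pq: "0 \<le> p" "p < q"
  shows "derivate_gap g 1 p q \<in> null_sets lborel"
proof -
  let ?B = "derivate_gap g 1 p q" and ?M = "interval_measure g"
  \<comment> \<open>Total increments are handled as the Stieltjes measure of \<open>g\<close>;
    continuity of \<open>g\<close> excludes atoms at the endpoints.\<close>
  have em: "emeasure ?M {a..b} = ennreal (g b - g a)" if "a \<le> b" for a b
    by (rule emeasure_interval_measure_Icc) (use that mono cont in auto)
  have fine: "\<exists>a b. a < x \<and> x < b \<and> b - a < d \<and> g b - g a < p * (b - a)"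
     "\<exists>a b. a < x \<and> x < b \<and> b - a < d \<and> g b - g a > q * (b - a)" if x: "x \<in> ?B" and d: "0 < d" for x d
  proof -
    obtain k :: nat where k: "1 / Suc k < d" using d nat_approx_posE by blast
    have "x \<in> {x. \<exists>a b. a < 0 \<and> 0 < b \<and> b - a < 1 / Suc k \<and> g (x + b *\<^sub>R 1) - g (x + a *\<^sub>R 1) < p * (b - a)}"
      "x \<in> {x. \<exists>a b. a < 0 \<and> 0 < b \<and> b - a < 1 / Suc k \<and> g (x + b *\<^sub>R 1) - g (x + a *\<^sub>R 1) > q * (b - a)}"
      using x unfolding derivate_gap_def by blast+
    then obtain a b a' b' where ab: "a < 0" "0 < b" "b - a < 1 / Suc k" "g (x + b) - g (x + a) < p * (b - a)"
        "a' < 0" "0 < b'" "b' - a' < 1 / Suc k" "g (x + b') - g (x + a') > q * (b' - a')"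
      by auto
    show "\<exists>a b. a < x \<and> x < b \<and> b - a < d \<and> g b - g a < p * (b - a)"
      by (rule exI[of _ "x + a"], rule exI[of _ "x + b"]) (use ab k in auto)
    show "\<exists>a b. a < x \<and> x < b \<and> b - a < d \<and> g b - g a > q * (b - a)"
      by (rule exI[of _ "x + a'"], rule exI[of _ "x + b'"]) (use ab k in auto)
  qed
  have null: "E \<in> null_sets lborel" if E: "E \<in> sets borel" "E \<subseteq> ?B" "emeasure lborel E < \<infinity>" for E
  proof -
    have bound: "q * measure lborel E \<le> p * (measure lborel E + \<epsilon>)" if "\<epsilon> > 0" for \<epsilon>
    proof -
      have "E \<in> sets lebesgue" using E(1) by (simp add: sets_completionI_sets)
      then obtain U where U: "open U" "E \<subseteq> U" "emeasure lebesgue (U - E) < ennreal \<epsilon>"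
        using sets_lebesgue_outer_open[OF _ \<open>\<epsilon> > 0\<close>] by metis
      have "U - E \<in> sets lborel" using U(1) E(1) by simp
      then have U3: "emeasure lborel (U - E) < ennreal \<epsilon>"
        using U(3) by simp
      have mU: "emeasure lborel U \<le> ennreal (measure lborel E + \<epsilon>)"
      proof -
        have "emeasure lborel U \<le> emeasure lborel (E \<union> (U - E))"
          using U E by (intro emeasure_mono) auto
        also have "\<dots> \<le> emeasure lborel E + emeasure lborel (U - E)"
          using U E by (intro emeasure_subadditive) auto
        also have "\<dots> \<le> ennreal (measure lborel E) + ennreal \<epsilon>"
          using U E by (intro add_mono) (auto simp: emeasure_eq_ennreal_measure top.not_eq_extremum less_imp_le U3)
        finally show ?thesis using \<open>\<epsilon> > 0\<close> by (simp add: ennreal_plus)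
      qed
      obtain C where C: "countable C" "\<And>a b. (a, b) \<in> C \<Longrightarrow> a < b \<and> g b - g a < p * (b - a) \<and> {a..b} \<subseteq> U"
          "disjoint_family_on (\<lambda>(a, b). {a..b}) C" "negligible (E - (\<Union>(a, b)\<in>C. {a<..<b}))"
        by (rule Vitali_covering_Icc[of U E "\<lambda>a b. g b - g a < p * (b - a)"]) (use U(1,2) E(2) fine(1) in \<open>auto dest!: subsetD\<close>)
      \<comment> \<open>Taking open intervals makes \<open>V\<close> open, so the second cover can
        be chosen inside the first.\<close>
      define V where "V = (\<Union>(a, b)\<in>C. {a<..<b})"
      have oV: "open V" unfolding V_def by (auto intro!: open_UN)
      obtain D where D: "countable D" "\<And>a b. (a, b) \<in> D \<Longrightarrow> a < b \<and> g b - g a > q * (b - a) \<and> {a..b} \<subseteq> V"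
          "disjoint_family_on (\<lambda>(a, b). {a..b}) D" "negligible ((E \<inter> V) - (\<Union>(a, b)\<in>D. {a<..<b}))"
        by (rule Vitali_covering_Icc[of V "E \<inter> V" "\<lambda>a b. g b - g a > q * (b - a)"]) (use oV E(2) fine(2) in \<open>auto dest!: subsetD\<close>)
      define W where "W = (\<Union>(a, b)\<in>D. {a..b})"
      have Wb: "W \<in> sets borel" unfolding W_def using D(1) by (intro sets.countable_UN') auto
      have "negligible ((E - V) \<union> ((E \<inter> V) - (\<Union>(a, b)\<in>D. {a<..<b})))"
        using C D by (auto simp: V_def)
      then have "negligible (E - W)"
      proof (rule negligible_subset)
        have "(\<Union>(a, b)\<in>D. {a<..<b}) \<subseteq> W" unfolding W_def by (intro UN_mono) auto
        then show "E - W \<subseteq> (E - V) \<union> ((E \<inter> V) - (\<Union>(a, b)\<in>D. {a<..<b}))" by blast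
      qed
      then have EW: "emeasure lborel (E - W) = 0"
        using negligible_iff_emeasure0[of "E - W"] E(1) Wb by (simp add: sets_completionI_sets)
      \<comment> \<open>Disjointness of each cover turns the slope bounds on single intervals into
        bounds for the measures of the unions.\<close>
      have "ennreal (q * measure lborel E) = ennreal q * emeasure lborel E"
        using E pq by (simp add: emeasure_eq_ennreal_measure top.not_eq_extremum ennreal_mult)
      also have "emeasure lborel E \<le> emeasure lborel (W \<union> (E - W))"
        using E Wb by (intro emeasure_mono) auto
      also have "\<dots> \<le> emeasure lborel W + emeasure lborel (E - W)"
        using E Wb by (intro emeasure_subadditive) auto
      also have "\<dots> = emeasure lborel W" using EW by simp
      also have "\<dots> = (\<integral>\<^sup>+i. emeasure lborel (case i of (a, b) \<Rightarrow> {a..b}) \<partial>count_space D)"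
        unfolding W_def using D by (intro emeasure_UN_countable) auto
      also have "ennreal q * \<dots> = (\<integral>\<^sup>+i. ennreal q * emeasure lborel (case i of (a, b) \<Rightarrow> {a..b}) \<partial>count_space D)"
        by (simp add: nn_integral_cmult)
      also have "\<dots> \<le> (\<integral>\<^sup>+i. emeasure ?M (case i of (a, b) \<Rightarrow> {a..b}) \<partial>count_space D)"
      proof (rule nn_integral_mono)
        fix i assume "i \<in> space (count_space D)"
        then obtain a b where i: "i = (a, b)" "(a, b) \<in> D" by (cases i) auto
        show "ennreal q * emeasure lborel (case i of (a, b) \<Rightarrow> {a..b}) \<le> emeasure ?M (case i of (a, b) \<Rightarrow> {a..b})"
          using D(2)[OF i(2)] pq i by (auto simp: em ennreal_mult[symmetric] intro!: ennreal_leI)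
      qed
      also have "\<dots> = emeasure ?M W"
        unfolding W_def using D by (intro emeasure_UN_countable[symmetric]) auto
      also have "\<dots> \<le> emeasure ?M (\<Union>(a, b)\<in>C. {a..b})"
      proof (rule emeasure_mono)
        have "W \<subseteq> V" using D(2) by (auto simp: W_def)
        also have "V \<subseteq> (\<Union>(a, b)\<in>C. {a..b})" unfolding V_def by (intro UN_mono) auto
        finally show "W \<subseteq> (\<Union>(a, b)\<in>C. {a..b})" .
        show "(\<Union>(a, b)\<in>C. {a..b}) \<in> sets ?M" using C(1) by (intro sets.countable_UN') auto
      qed
      also have "\<dots> = (\<integral>\<^sup>+i. emeasure ?M (case i of (a, b) \<Rightarrow> {a..b}) \<partial>count_space C)"
        using C by (intro emeasure_UN_countable) auto
      also have "\<dots> \<le> (\<integral>\<^sup>+i. ennreal p * emeasure lborel (case i of (a, b) \<Rightarrow> {a..b}) \<partial>count_space C)"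
      proof (rule nn_integral_mono)
        fix i assume "i \<in> space (count_space C)"
        then obtain a b where i: "i = (a, b)" "(a, b) \<in> C" by (cases i) auto
        show "emeasure ?M (case i of (a, b) \<Rightarrow> {a..b}) \<le> ennreal p * emeasure lborel (case i of (a, b) \<Rightarrow> {a..b})"
          using C(2)[OF i(2)] pq i by (auto simp: em ennreal_mult[symmetric] intro!: ennreal_leI)
      qed
      also have "\<dots> = ennreal p * (\<integral>\<^sup>+i. emeasure lborel (case i of (a, b) \<Rightarrow> {a..b}) \<partial>count_space C)"
        by (simp add: nn_integral_cmult)
      also have "(\<integral>\<^sup>+i. emeasure lborel (case i of (a, b) \<Rightarrow> {a..b}) \<partial>count_space C) = emeasure lborel (\<Union>(a, b)\<in>C. {a..b})"
        using C by (intro emeasure_UN_countable[symmetric]) auto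
      also have "\<dots> \<le> emeasure lborel U"
        using C(2) U by (intro emeasure_mono) auto
      also have "\<dots> \<le> ennreal (measure lborel E + \<epsilon>)" by (rule mU)
      finally have "ennreal (q * measure lborel E) \<le> ennreal p * ennreal (measure lborel E + \<epsilon>)"
        by (simp add: mult_left_mono)
      then have "ennreal (q * measure lborel E) \<le> ennreal (p * (measure lborel E + \<epsilon>))"
        using pq \<open>\<epsilon> > 0\<close> by (subst ennreal_mult) auto
      then show ?thesis using pq \<open>\<epsilon> > 0\<close> by (subst (asm) ennreal_le_iff) auto
    qed
    have "measure lborel E = 0"
    proof (rule ccontr)
      assume "measure lborel E \<noteq> 0"
      then have m: "measure lborel E > 0" by (simp add: zero_less_measure_iff)
      \<comment> \<open>Chosen so that \<open>p * \<epsilon> < (q - p) * measure lborel E\<close>,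
        which contradicts \<open>bound\<close>; the denominator \<open>p + 1\<close> is positive
        even if \<open>p = 0\<close>.\<close>
      define \<epsilon> where "\<epsilon> = (q - p) * measure lborel E / (p + 1)"
      have "\<epsilon> > 0" using m pq by (simp add: \<epsilon>_def)
      have "p * \<epsilon> < (q - p) * measure lborel E"
        using m pq by (simp add: \<epsilon>_def divide_simps)
      with bound[OF \<open>\<epsilon> > 0\<close>] show False by (simp add: algebra_simps)
    qed
    then show ?thesis using E by (simp add: emeasure_eq_ennreal_measure top.not_eq_extremum null_setsI)
  qed
  \<comment> \<open>The argument for \<open>null\<close> requires finite measure, so the gap set is
    exhausted by bounded pieces.\<close>
  have "(\<Union>k::nat. ?B \<inter> {- real k..real k}) \<in> null_sets lborel"
  proof (rule null_sets_UN)
    fix k :: nat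
    have "emeasure lborel (?B \<inter> {- real k..real k}) \<le> emeasure lborel {- real k..real k}"
      by (intro emeasure_mono) auto
    also have "\<dots> < \<infinity>" by simp
    finally show "?B \<inter> {- real k..real k} \<in> null_sets lborel"
      using derivate_gap_borel[OF cont] by (intro null) auto
  qed
  also have "(\<Union>k::nat. ?B \<inter> {- real k..real k}) = ?B"
  proof (intro equalityI subsetI)
    fix x assume x: "x \<in> ?B"
    obtain k :: nat where "\<bar>x\<bar> \<le> real k" using real_arch_simple by blast
    then have "x \<in> {- real k..real k}" by (auto simp: abs_le_iff)
    with x show "x \<in> (\<Union>k::nat. ?B \<inter> {- real k..real k})" by blast
  qed auto
  finally show ?thesis .
qed

text \<open>Adding the linear function with slope \<open>M = L + \<bar>p\<bar>\<close> makes
  \<open>g\<close> increasing and raises all straddling slopes by \<open>M\<close>, so the gap set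
  for \<open>p\<close>, \<open>q\<close> becomes the one for \<open>p + M \<ge> 0\<close> and
  \<open>q + M\<close>.\<close>

lemma null_sets_derivate_gap_real:
  fixes g :: "real \<Rightarrow> real"
  assumes lip: "L-lipschitz_on UNIV g" and pq: "p < q"
  shows "derivate_gap g 1 p q \<in> null_sets lborel"
proof -
  define M where "M = L + \<bar>p\<bar>"
  have "L \<ge> 0" using lip lipschitz_on_nonneg by blast
  have "derivate_gap g 1 p q = derivate_gap (\<lambda>x. g x + M * x) 1 (p + M) (q + M)"
    unfolding derivate_gap_def by (simp add: algebra_simps)
  also have "\<dots> \<in> null_sets lborel"
  proof (rule null_sets_derivate_gap_mono)
    fix x y :: real assume "x \<le> y"
    have "\<bar>g x - g y\<bar> \<le> L * (y - x)"
      using lipschitz_onD[OF lip, of x y] \<open>x \<le> y\<close> by (simp add: dist_real_def)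
    also have "\<dots> \<le> M * (y - x)"
      using \<open>x \<le> y\<close> by (intro mult_right_mono) (auto simp: M_def)
    finally show "g x + M * x \<le> g y + M * y" by (simp add: algebra_simps)
  next
    show "continuous_on UNIV (\<lambda>x. g x + M * x)"
      by (intro continuous_intros lipschitz_on_continuous_on[OF lip])
  qed (use pq \<open>L \<ge> 0\<close> in \<open>auto simp: M_def\<close>)
  finally show ?thesis .
qed

text \<open>One-sided difference quotients are limits of straddling ones: by continuity at
  \<open>0\<close>, the other end of the interval may be moved to \<open>0\<close>.\<close>

lemma DERIV_if_straddle:
  fixes g :: "real \<Rightarrow> real"
  assumes cont: "isCont g 0"
    and str: "\<And>\<epsilon>. \<epsilon> > 0 \<Longrightarrow> \<exists>d>0. \<forall>a b. a < 0 \<longrightarrow> 0 < b \<longrightarrow> b - a < d \<longrightarrow> \<bar>g b - g a - D * (b - a)\<bar> \<le> \<epsilon> * (b - a)"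
  shows "DERIV g 0 :> D"
  unfolding has_field_derivative_def has_derivative_at_alt
proof (intro conjI allI impI)
  show "bounded_linear ((*) D)" by (rule bounded_linear_mult_right)
  fix \<epsilon> :: real assume "0 < \<epsilon>"
  then obtain d where d: "d > 0" "\<And>a b. a < 0 \<Longrightarrow> 0 < b \<Longrightarrow> b - a < d \<Longrightarrow> \<bar>g b - g a - D * (b - a)\<bar> \<le> \<epsilon> * (b - a)"
    using str by blast
  have tl: "(g \<longlongrightarrow> g 0) (at_left 0)" and tr: "(g \<longlongrightarrow> g 0) (at_right 0)"
    using cont filterlim_at_split unfolding continuous_at by blast+
  have r: "\<bar>g b - g 0 - D * b\<bar> \<le> \<epsilon> * b" if "0 < b" "b < d" for b
  proof (rule tendsto_le)
    show "((\<lambda>a. \<bar>g b - g a - D * (b - a)\<bar>) \<longlongrightarrow> \<bar>g b - g 0 - D * b\<bar>) (at_left 0)"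
      by (rule tendsto_eq_intros tl refl | simp)+
    show "((\<lambda>a. \<epsilon> * (b - a)) \<longlongrightarrow> \<epsilon> * b) (at_left 0)"
      by (rule tendsto_eq_intros refl | simp)+
    show "\<forall>\<^sub>F a in at_left 0. \<bar>g b - g a - D * (b - a)\<bar> \<le> \<epsilon> * (b - a)"
      unfolding eventually_at_left_field
      by (rule exI[of _ "b - d"]) (use that d in auto)
  qed simp
  have l: "\<bar>g 0 - g a - D * (- a)\<bar> \<le> \<epsilon> * (- a)" if "a < 0" "- a < d" for a
  proof (rule tendsto_le)
    show "((\<lambda>b. \<bar>g b - g a - D * (b - a)\<bar>) \<longlongrightarrow> \<bar>g 0 - g a - D * (- a)\<bar>) (at_right 0)"
      by (rule tendsto_eq_intros tr refl | simp)+
    show "((\<lambda>b. \<epsilon> * (b - a)) \<longlongrightarrow> \<epsilon> * (- a)) (at_right 0)"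
      by (rule tendsto_eq_intros refl | simp)+
    show "\<forall>\<^sub>F b in at_right 0. \<bar>g b - g a - D * (b - a)\<bar> \<le> \<epsilon> * (b - a)"
      unfolding eventually_at_right_field
      by (rule exI[of _ "a + d"]) (use that d in auto)
  qed simp
  show "\<exists>d>0. \<forall>y. norm (y - 0) < d \<longrightarrow> norm (g y - g 0 - D * (y - 0)) \<le> \<epsilon> * norm (y - 0)"
  proof (intro exI[of _ d] conjI allI impI)
    fix y :: real assume y: "norm (y - 0) < d"
    consider "y > 0" | "y < 0" | "y = 0" by linarith
    then show "norm (g y - g 0 - D * (y - 0)) \<le> \<epsilon> * norm (y - 0)"
    proof cases
      case 1 then show ?thesis using r[of y] y by simp
    next
      case 2 then show ?thesis using l[of y] y by (simp add: abs_if split: if_splits)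
    qed simp
  qed (use d in auto)
qed

text \<open>The lower straddling derivate \<open>D\<close> always exists for a Lipschitz function.
  If quotients stayed above it by a fixed amount on arbitrarily short intervals, two rationals in
  between would witness a gap.\<close>

lemma line_differentiable_if_no_gap:
  fixes u :: "'a::real_normed_vector \<Rightarrow> real"
  assumes lip: "L-lipschitz_on UNIV u"
    and x: "\<And>p q. p \<in> \<rat> \<Longrightarrow> q \<in> \<rat> \<Longrightarrow> p < q \<Longrightarrow> x \<notin> derivate_gap u e p q"
  shows "\<exists>D. DERIV (\<lambda>t. u (x + t *\<^sub>R e)) 0 :> D"
proof -
  define g where "g = (\<lambda>t. u (x + t *\<^sub>R e))"
  define M where "M = L * norm e"
  have "L \<ge> 0" using lip lipschitz_on_nonneg by blast
  have gl: "\<bar>g b - g a\<bar> \<le> M * (b - a)" if "a \<le> b" for a b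
  proof -
    have "\<bar>g b - g a\<bar> \<le> L * norm ((x + b *\<^sub>R e) - (x + a *\<^sub>R e))"
      using lipschitz_onD[OF lip, of "x + b *\<^sub>R e" "x + a *\<^sub>R e"] by (simp add: g_def dist_norm)
    also have "(x + b *\<^sub>R e) - (x + a *\<^sub>R e) = (b - a) *\<^sub>R e" by (simp add: scaleR_diff_left)
    finally show ?thesis using that by (simp add: M_def mult_ac)
  qed
  \<comment> \<open>The lower bounds of all sufficiently short straddling quotients. The Lipschitz
    bound puts \<open>- M\<close> into \<open>low\<close> and bounds it above by \<open>M\<close>,
    so \<open>Sup low\<close> is a finite number.\<close>
  define low where "low = {p. \<exists>d>0. \<forall>a b. a < 0 \<longrightarrow> 0 < b \<longrightarrow> b - a < d \<longrightarrow> p * (b - a) \<le> g b - g a}"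
  have "- M \<in> low" unfolding low_def using gl
    by (auto intro!: exI[of _ "1::real"] simp: abs_le_iff minus_le_iff)
  have bdd: "p \<le> M" if p: "p \<in> low" for p
  proof -
    obtain d where d: "d > 0" "\<And>a b. a < 0 \<Longrightarrow> 0 < b \<Longrightarrow> b - a < d \<Longrightarrow> p * (b - a) \<le> g b - g a"
      using p unfolding low_def by blast
    have "p * (d / 3 - - d / 3) \<le> g (d / 3) - g (- d / 3)" using d by (intro d) auto
    also have "\<dots> \<le> M * (d / 3 - - d / 3)" using gl[of "- d / 3" "d / 3"] d by linarith
    finally show ?thesis using d by simp
  qed
  then have bddl: "bdd_above low" by (auto simp: bdd_above_def)
  define D where "D = Sup low"
  have "DERIV g 0 :> D"
  proof (rule DERIV_if_straddle)
    have "continuous_on UNIV g"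
      unfolding g_def by (intro continuous_intros continuous_on_compose2[OF lipschitz_on_continuous_on[OF lip]]) auto
    then show "isCont g 0" by (simp add: continuous_on_eq_continuous_at)
    fix \<epsilon> :: real assume e: "\<epsilon> > 0"
    obtain p0 where p0: "p0 \<in> low" "D - \<epsilon> < p0"
      using less_cSupE[of "D - \<epsilon>" low] e \<open>- M \<in> low\<close> unfolding D_def by auto
    then obtain d where d: "d > 0" "\<And>a b. a < 0 \<Longrightarrow> 0 < b \<Longrightarrow> b - a < d \<Longrightarrow> p0 * (b - a) \<le> g b - g a"
      unfolding low_def by blast
    \<comment> \<open>Since \<open>p > D\<close> is not in \<open>low\<close>, arbitrarily short
      intervals have slope below \<open>p\<close>. As \<open>x\<close> has no gap for
      \<open>p < q\<close>, at some scale \<open>1 / Suc k\<close> no slope exceeds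
      \<open>q < D + \<epsilon>\<close>.\<close>
    obtain p where p: "p \<in> \<rat>" "D < p" "p < D + \<epsilon>" using Rats_dense_in_real[of D "D + \<epsilon>"] e by auto
    obtain q where q: "q \<in> \<rat>" "p < q" "q < D + \<epsilon>" using Rats_dense_in_real[of p "D + \<epsilon>"] p by auto
    have "p \<notin> low" using p cSup_upper[OF _ bddl] unfolding D_def by force
    then have nlow: "\<exists>a b. a < 0 \<and> 0 < b \<and> b - a < d \<and> g b - g a < p * (b - a)" if "d > 0" for d
      using that unfolding low_def by (auto simp: not_le)
    obtain k :: nat where k: "\<not> (\<exists>a b. a < 0 \<and> 0 < b \<and> b - a < 1 / Suc k \<and> g b - g a > q * (b - a))"
      using x[OF p(1) q(1,2)] nlow[of "1 / Suc _"] unfolding derivate_gap_def g_def by auto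
    show "\<exists>d>0. \<forall>a b. a < 0 \<longrightarrow> 0 < b \<longrightarrow> b - a < d \<longrightarrow> \<bar>g b - g a - D * (b - a)\<bar> \<le> \<epsilon> * (b - a)"
    proof (intro exI[of _ "min d (1 / Suc k)"] conjI allI impI)
      fix a b :: real assume ab: "a < 0" "0 < b" "b - a < min d (1 / Suc k)"
      have "\<not> g b - g a > q * (b - a)" using k ab by (meson min_less_iff_conj)
      then have "g b - g a \<le> q * (b - a)" by simp
      also have "\<dots> \<le> (D + \<epsilon>) * (b - a)" using ab q by (intro mult_right_mono) auto
      finally have 1: "g b - g a \<le> (D + \<epsilon>) * (b - a)" .
      have "(D - \<epsilon>) * (b - a) \<le> p0 * (b - a)" using ab p0 by (intro mult_right_mono) auto
      also have "\<dots> \<le> g b - g a" using d ab by auto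
      finally show "\<bar>g b - g a - D * (b - a)\<bar> \<le> \<epsilon> * (b - a)"
        using 1 by (simp add: abs_le_iff algebra_simps)
    qed (use d in auto)
  qed
  then show ?thesis unfolding g_def by blast
qed

section \<open>From lines to the whole space\<close>

lemma nn_integral_lborel_translate:
  fixes f :: "'a::euclidean_space \<Rightarrow> ennreal"
  assumes [measurable]: "f \<in> borel_measurable borel"
  shows "(\<integral>\<^sup>+x. f (x + c) \<partial>lborel) = (\<integral>\<^sup>+x. f x \<partial>lborel)"
  by (subst (2) lborel_distr_plus[of c, symmetric]) (simp add: nn_integral_distr add.commute)

text \<open>Translates of \<open>N\<close> along \<open>e\<close> all have the same measure.
  Averaging over translates with parameter in \<open>{0..1}\<close>, an interval of length 1, and
  exchanging the integrals leaves inner integrals along lines, which vanish.\<close>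

lemma null_sets_lborel_if_null_on_lines:
  fixes N :: "'a::euclidean_space set"
  assumes [measurable]: "N \<in> sets borel"
    and null: "\<And>x. {t. x + t *\<^sub>R e \<in> N} \<in> null_sets lborel"
  shows "N \<in> null_sets lborel"
proof -
  have [measurable]: "(\<lambda>x. indicator N x :: ennreal) \<in> borel_measurable borel" by simp
  have "emeasure lborel N = (\<integral>\<^sup>+t. (\<integral>\<^sup>+x. indicator N x \<partial>lborel) * indicator {0..1} (t::real) \<partial>lborel)"
    by (subst nn_integral_cmult) auto
  also have "\<dots> = (\<integral>\<^sup>+t. (\<integral>\<^sup>+(x::'a). indicator N (x + t *\<^sub>R e) * indicator {0..1} (t::real) \<partial>lborel) \<partial>lborel)"
    by (subst nn_integral_multc) (auto simp: nn_integral_lborel_translate)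
  also have "\<dots> = (\<integral>\<^sup>+(x::'a). (\<integral>\<^sup>+t. indicator N (x + t *\<^sub>R e) * indicator {0..1} (t::real) \<partial>lborel) \<partial>lborel)"
    by (rule lborel_pair.Fubini') (measurable)
  also have "\<dots> = (\<integral>\<^sup>+(x::'a). 0 \<partial>lborel)"
  proof (rule nn_integral_cong)
    fix x :: 'a
    have "AE t in lborel. indicator N (x + t *\<^sub>R e) * indicator {0..1} t = (0::ennreal)"
      using AE_not_in[OF null[of x]] by eventually_elim auto
    then have "(\<integral>\<^sup>+t. indicator N (x + t *\<^sub>R e) * indicator {0..1} (t::real) \<partial>lborel) = (\<integral>\<^sup>+(t::real). 0 \<partial>lborel)"
      by (rule nn_integral_cong_AE)
    then show "(\<integral>\<^sup>+t. indicator N (x + t *\<^sub>R e) * indicator {0..1} (t::real) \<partial>lborel) = (0::ennreal)" by simp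
  qed
  finally show ?thesis by (auto intro!: null_setsI)
qed

text \<open>The exceptional points lie in the gap sets for rational \<open>p < q\<close>, a
  countable family. On each line parallel to \<open>e\<close> such a set is the gap set of a
  Lipschitz function of one variable, hence null.\<close>

lemma AE_line_differentiable:
  fixes u :: "'a::euclidean_space \<Rightarrow> real"
  assumes lip: "L-lipschitz_on UNIV u"
  shows "AE x in lborel. \<exists>D. DERIV (\<lambda>t. u (x + t *\<^sub>R e)) 0 :> D"
proof -
  have "derivate_gap u e p q \<in> null_sets lborel" if "p < q" for p q
  proof (rule null_sets_lborel_if_null_on_lines[of _ e])
    show "derivate_gap u e p q \<in> sets borel"
      by (rule derivate_gap_borel[OF lipschitz_on_continuous_on[OF lip]])
    fix x
    have "{t. x + t *\<^sub>R e \<in> derivate_gap u e p q} = derivate_gap (\<lambda>s. u (x + s *\<^sub>R e)) 1 p q"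
      unfolding derivate_gap_def by (auto simp: scaleR_add_left add.assoc)
    also have "\<dots> \<in> null_sets lborel"
    proof (rule null_sets_derivate_gap_real[OF _ that])
      show "(L * norm e)-lipschitz_on UNIV (\<lambda>s. u (x + s *\<^sub>R e))"
      proof (rule lipschitz_onI)
        fix s t :: real
        have "dist (u (x + s *\<^sub>R e)) (u (x + t *\<^sub>R e)) \<le> L * norm ((x + s *\<^sub>R e) - (x + t *\<^sub>R e))"
          using lipschitz_onD[OF lip, of "x + s *\<^sub>R e" "x + t *\<^sub>R e"] by (simp add: dist_norm)
        also have "(x + s *\<^sub>R e) - (x + t *\<^sub>R e) = (s - t) *\<^sub>R e" by (simp add: scaleR_diff_left)
        finally show "dist (u (x + s *\<^sub>R e)) (u (x + t *\<^sub>R e)) \<le> L * norm e * dist s t"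
          by (simp add: dist_norm mult_ac)
      next
        show "0 \<le> L * norm e" using lipschitz_on_nonneg[OF lip] by simp
      qed
    qed
    finally show "{t. x + t *\<^sub>R e \<in> derivate_gap u e p q} \<in> null_sets lborel" .
  qed
  then have "(\<Union>(p, q)\<in>{(p, q). p \<in> \<rat> \<and> q \<in> \<rat> \<and> p < q}. derivate_gap u e p q) \<in> null_sets lborel"
  proof (intro null_sets_UN')
    have "countable (\<rat> \<times> \<rat> :: (real \<times> real) set)" by (intro countable_SIGMA countable_rat)
    then show "countable {(p, q). p \<in> \<rat> \<and> q \<in> \<rat> \<and> p < (q::real)}"
      by (rule countable_subset[rotated]) auto
  qed auto
  then have "AE x in lborel. x \<notin> (\<Union>(p, q)\<in>{(p, q). p \<in> \<rat> \<and> q \<in> \<rat> \<and> p < q}. derivate_gap u e p q)"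
    by (rule AE_not_in)
  then show ?thesis
    by eventually_elim (rule line_differentiable_if_no_gap[OF lip], auto)
qed

section \<open>The Dirichlet energy\<close>

text \<open>
  Where \<^const>\<open>deriv\<close> along the line exists it has this value; unlike \<^const>\<open>deriv\<close>, this
  function is evidently Borel measurable.
\<close>

definition dir_deriv :: "('a::real_normed_vector \<Rightarrow> real) \<Rightarrow> 'a \<Rightarrow> 'a \<Rightarrow> real" where
  "dir_deriv u e x = lim (\<lambda>k. real (Suc k) * (u (x + (1 / real (Suc k)) *\<^sub>R e) - u x))"

lemma dir_deriv_tendsto:
  fixes u :: "'a::real_normed_vector \<Rightarrow> real"
  assumes "DERIV (\<lambda>t. u (x + t *\<^sub>R e)) 0 :> D"
  shows "(\<lambda>k. real (Suc k) * (u (x + (1 / real (Suc k)) *\<^sub>R e) - u x)) \<longlonglongrightarrow> D"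
proof -
  have "((\<lambda>h. (u (x + h *\<^sub>R e) - u x) / h) \<longlongrightarrow> D) (at 0)"
    using DERIV_D[OF assms] by (simp only: scaleR_zero_left add_0_right add_0_left)
  moreover have "filterlim (\<lambda>k. 1 / real (Suc k)) (at 0) sequentially"
    unfolding filterlim_at using lim_1_over_n[THEN LIMSEQ_Suc] by auto
  ultimately show ?thesis
    by (auto dest: filterlim_compose simp: field_simps)
qed

lemma dir_deriv_eq:
  fixes u :: "'a::real_normed_vector \<Rightarrow> real"
  shows "DERIV (\<lambda>t. u (x + t *\<^sub>R e)) 0 :> D \<Longrightarrow> dir_deriv u e x = D"
  unfolding dir_deriv_def by (rule limI[OF dir_deriv_tendsto])

lemma AE_DERIV_dir_deriv:
  fixes u :: "'a::euclidean_space \<Rightarrow> real"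
  assumes "L-lipschitz_on UNIV u"
  shows "AE x in lborel. DERIV (\<lambda>t. u (x + t *\<^sub>R e)) 0 :> dir_deriv u e x"
  using AE_line_differentiable[OF assms, of e] by eventually_elim (auto simp: dir_deriv_eq)

lemma borel_measurable_lipschitz:
  fixes u :: "'a::real_normed_vector \<Rightarrow> real"
  shows "L-lipschitz_on UNIV u \<Longrightarrow> u \<in> borel_measurable borel"
  by (intro borel_measurable_continuous_onI lipschitz_on_continuous_on)

lemma borel_measurable_dir_deriv [measurable (raw)]:
  fixes u :: "'a::euclidean_space \<Rightarrow> real"
  assumes [measurable]: "u \<in> borel_measurable borel"
  shows "dir_deriv u e \<in> borel_measurable borel"
  unfolding dir_deriv_def by measurable

text \<open>A Borel version of the squared norm of \<open>gradient u\<close>, with which it agrees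
  wherever all partial derivatives exist.\<close>

definition grad_sq :: "(real ^ 'n \<Rightarrow> real) \<Rightarrow> real ^ 'n \<Rightarrow> real" where
  "grad_sq u x = (\<Sum>i\<in>UNIV. (dir_deriv u (axis i 1) x)\<^sup>2)"

lemma borel_measurable_grad_sq [measurable (raw)]:
  assumes [measurable]: "u \<in> borel_measurable borel"
  shows "grad_sq u \<in> borel_measurable borel"
  unfolding grad_sq_def by measurable

lemma grad_sq_nonneg: "0 \<le> grad_sq u x"
  unfolding grad_sq_def by (intro sum_nonneg) auto

definition dirichlet_energy :: "(real ^ 'n \<Rightarrow> real) \<Rightarrow> ennreal" where
  "dirichlet_energy u = (\<integral>\<^sup>+ x. ennreal ((norm (gradient u x))\<^sup>2) \<partial>lborel)"

text \<open>Almost every point has all partial derivatives at once, there being finitely many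
  directions; default values of \<open>deriv\<close> and \<open>lim\<close> only occur on a null
  set.\<close>

lemma dirichlet_energy_eq:
  assumes lip: "L-lipschitz_on UNIV u"
  shows "dirichlet_energy u = (\<integral>\<^sup>+ x. ennreal (grad_sq u x) \<partial>lborel)"
  unfolding dirichlet_energy_def
proof (rule nn_integral_cong_AE)
  have "AE x in lborel. \<forall>i. DERIV (\<lambda>t. u (x + t *\<^sub>R axis i 1)) 0 :> dir_deriv u (axis i 1) x"
    by (simp add: AE_all_countable AE_DERIV_dir_deriv[OF lip])
  then show "AE x in lborel. ennreal ((norm (gradient u x))\<^sup>2) = ennreal (grad_sq u x)"
  proof eventually_elim
    case (elim x)
    then have "gradient u x $ i = dir_deriv u (axis i 1) x" for i
      by (auto simp: gradient_def intro: DERIV_imp_deriv)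
    then show ?case
      by (simp add: grad_sq_def norm_vec_def L2_set_def sum_nonneg)
  qed
qed

section \<open>Shifts in L^2\<close>

definition shift_energy :: "('a::euclidean_space \<Rightarrow> real) \<Rightarrow> 'a \<Rightarrow> ennreal" where
  "shift_energy u h = (\<integral>\<^sup>+ x. ennreal ((u (x + h) - u x)\<^sup>2) \<partial>lborel)"

lemma shift_energy_add:
  assumes [measurable]: "u \<in> borel_measurable borel"
  shows "shift_energy u (h + k) \<le> 2 * shift_energy u h + 2 * shift_energy u k"
proof -
  have "shift_energy u (h + k)
      \<le> (\<integral>\<^sup>+ x. 2 * ennreal ((u (x + h) - u x)\<^sup>2) + 2 * ennreal ((u (x + h + k) - u (x + h))\<^sup>2) \<partial>lborel)"
    unfolding shift_energy_def
  proof (rule nn_integral_mono)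
    fix x
    have "(a + b)\<^sup>2 \<le> 2 * a\<^sup>2 + 2 * b\<^sup>2" for a b :: real
      using sum_squares_bound[of a b] by (simp add: power2_sum)
    from this[of "u (x + h) - u x" "u (x + h + k) - u (x + h)"]
    have "(u (x + (h + k)) - u x)\<^sup>2 \<le> 2 * (u (x + h) - u x)\<^sup>2 + 2 * (u (x + h + k) - u (x + h))\<^sup>2"
      by (simp add: add.assoc)
    then have "ennreal ((u (x + (h + k)) - u x)\<^sup>2) \<le> ennreal (2 * (u (x + h) - u x)\<^sup>2 + 2 * (u (x + h + k) - u (x + h))\<^sup>2)"
      by (rule ennreal_leI)
    then show "ennreal ((u (x + (h + k)) - u x)\<^sup>2)
      \<le> 2 * ennreal ((u (x + h) - u x)\<^sup>2) + 2 * ennreal ((u (x + h + k) - u (x + h))\<^sup>2)"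
      by (simp add: ennreal_plus ennreal_mult)
  qed
  also have "\<dots> = 2 * shift_energy u h + 2 * (\<integral>\<^sup>+ x. ennreal ((u (x + h + k) - u (x + h))\<^sup>2) \<partial>lborel)"
    unfolding shift_energy_def by (simp add: nn_integral_add nn_integral_cmult)
  also have "(\<integral>\<^sup>+ x. ennreal ((u (x + h + k) - u (x + h))\<^sup>2) \<partial>lborel) = shift_energy u k"
    unfolding shift_energy_def
    by (rule nn_integral_lborel_translate[of "\<lambda>x. ennreal ((u (x + k) - u x)\<^sup>2)"]) measurable
  finally show ?thesis .
qed

text \<open>Telescope the difference into \<open>n\<close> steps and apply Cauchy-Schwarz, which
  costs one factor \<open>n\<close>; the other comes from summing \<open>n\<close> terms that are
  equal by translation invariance.\<close>

lemma shift_energy_multiple: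
  assumes [measurable]: "u \<in> borel_measurable borel"
  shows "shift_energy u (real n *\<^sub>R h) \<le> ennreal ((real n)\<^sup>2) * shift_energy u h"
proof -
  have "shift_energy u (real n *\<^sub>R h)
      \<le> (\<integral>\<^sup>+ x. (\<Sum>k<n. ennreal n * ennreal ((u (x + real k *\<^sub>R h + h) - u (x + real k *\<^sub>R h))\<^sup>2)) \<partial>lborel)"
    unfolding shift_energy_def
  proof (rule nn_integral_mono)
    fix x
    have "u (x + real n *\<^sub>R h) - u x = (\<Sum>k<n. u (x + real (Suc k) *\<^sub>R h) - u (x + real k *\<^sub>R h))"
      by (subst sum_lessThan_telescope) simp
    also have "\<dots> = (\<Sum>k<n. u (x + real k *\<^sub>R h + h) - u (x + real k *\<^sub>R h))"
      by (simp add: scaleR_add_left algebra_simps)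
    finally have "(u (x + real n *\<^sub>R h) - u x)\<^sup>2 \<le> (\<Sum>k<n. n * (u (x + real k *\<^sub>R h + h) - u (x + real k *\<^sub>R h))\<^sup>2)"
      using sum_squared_le_sum_of_squares[of "\<lambda>k. u (x + real k *\<^sub>R h + h) - u (x + real k *\<^sub>R h)" "{..<n}"]
      by (simp add: sum_distrib_left[symmetric] mult.commute)
    then have "ennreal ((u (x + real n *\<^sub>R h) - u x)\<^sup>2) \<le> ennreal (\<Sum>k<n. n * (u (x + real k *\<^sub>R h + h) - u (x + real k *\<^sub>R h))\<^sup>2)"
      by (rule ennreal_leI)
    also have "\<dots> = (\<Sum>k<n. ennreal n * ennreal ((u (x + real k *\<^sub>R h + h) - u (x + real k *\<^sub>R h))\<^sup>2))"
      by (simp add: sum_ennreal[symmetric] ennreal_mult)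
    finally show "ennreal ((u (x + real n *\<^sub>R h) - u x)\<^sup>2) \<le> \<dots>" .
  qed
  also have "\<dots> = (\<Sum>k<n. ennreal n * (\<integral>\<^sup>+ x. ennreal ((u (x + real k *\<^sub>R h + h) - u (x + real k *\<^sub>R h))\<^sup>2) \<partial>lborel))"
    by (subst nn_integral_sum) (auto simp: nn_integral_cmult)
  also have "\<dots> = (\<Sum>k<n. ennreal n * shift_energy u h)"
    unfolding shift_energy_def
    by (intro sum.cong refl arg_cong2[where f="(*)"] nn_integral_lborel_translate[of "\<lambda>x. ennreal ((u (x + h) - u x)\<^sup>2)"]) measurable
  also have "\<dots> = ennreal ((real n)\<^sup>2) * shift_energy u h"
    by (simp add: power2_eq_square ennreal_mult ennreal_of_nat_eq_real_of_nat mult.assoc)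
  finally show ?thesis .
qed

text \<open>Difference quotients of step \<open>1/k\<close> have \<open>L\<^sup>2\<close> norm at least that of step \<open>1\<close>; letting
  \<open>k\<close> tend to infinity avoids the fundamental theorem of calculus for Lipschitz functions.\<close>

lemma shift_energy_le_dir_deriv:
  fixes u :: "'a::euclidean_space \<Rightarrow> real"
  assumes lip: "L-lipschitz_on UNIV u" and supp: "\<And>x. u x \<noteq> 0 \<Longrightarrow> norm x \<le> B"
  shows "shift_energy u e \<le> (\<integral>\<^sup>+ x. ennreal ((dir_deriv u e x)\<^sup>2) \<partial>lborel)"
proof -
  have [measurable]: "u \<in> borel_measurable borel" by (rule borel_measurable_lipschitz[OF lip])
  have [measurable]: "cball (0::'a) (B + norm e) \<in> sets borel" by simp
  let ?q = "\<lambda>k x. real (Suc k) * (u (x + (1 / real (Suc k)) *\<^sub>R e) - u x)"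
  have "(\<lambda>k. \<integral>\<^sup>+ x. ennreal ((?q k x)\<^sup>2) \<partial>lborel) \<longlonglongrightarrow> (\<integral>\<^sup>+ x. ennreal ((dir_deriv u e x)\<^sup>2) \<partial>lborel)"
  \<comment> \<open>The quotients are bounded by \<open>L * norm e\<close>, and they vanish outside
    the ball of radius \<open>B + norm e\<close>, where both points of the quotient are off the
    support of \<open>u\<close>.\<close>
  proof (rule nn_integral_dominated_convergence[where w="\<lambda>x. ennreal ((L * norm e)\<^sup>2) * indicator (cball 0 (B + norm e)) x"])
    fix k
    have "ennreal ((?q k x)\<^sup>2) \<le> ennreal ((L * norm e)\<^sup>2) * indicator (cball 0 (B + norm e)) x" for x
    proof (cases "x \<in> cball 0 (B + norm e)")
      case True
      have "\<bar>u (x + (1 / real (Suc k)) *\<^sub>R e) - u x\<bar> \<le> L * norm ((1 / real (Suc k)) *\<^sub>R e)"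
        using lipschitz_onD[OF lip, of "x + (1 / real (Suc k)) *\<^sub>R e" x] by (simp add: dist_norm)
      then have "\<bar>?q k x\<bar> \<le> L * norm e" by (simp add: abs_mult divide_simps mult_ac)
      then have "(?q k x)\<^sup>2 \<le> (L * norm e)\<^sup>2" by (metis abs_ge_zero power2_abs power_mono)
      then show ?thesis using True by (simp add: ennreal_leI)
    next
      case False
      have "norm ((1 / real (Suc k)) *\<^sub>R e) \<le> norm e" by (simp add: divide_simps mult_le_cancel_left1)
      moreover have "norm x \<le> norm (x + (1 / real (Suc k)) *\<^sub>R e) + norm ((1 / real (Suc k)) *\<^sub>R e)"
        by (metis add_diff_cancel_right' norm_triangle_ineq4)
      ultimately have "norm (x + (1 / real (Suc k)) *\<^sub>R e) > B"
        using False by (auto simp: not_le)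
      moreover have "norm x > B" using False norm_ge_zero[of e] by (simp add: not_le del: norm_ge_zero)
      ultimately have "u (x + (1 / real (Suc k)) *\<^sub>R e) = 0" "u x = 0" using supp by force+
      then show ?thesis by simp
    qed
    then show "AE x in lborel. ennreal ((?q k x)\<^sup>2) \<le> ennreal ((L * norm e)\<^sup>2) * indicator (cball 0 (B + norm e)) x"
      by simp
  next
    have "(\<integral>\<^sup>+ x. ennreal ((L * norm e)\<^sup>2) * indicator (cball (0::'a) (B + norm e)) x \<partial>lborel)
       = ennreal ((L * norm e)\<^sup>2) * emeasure lborel (cball (0::'a) (B + norm e))"
      by (rule nn_integral_cmult_indicator) simp
    also have "\<dots> < \<infinity>"
      using emeasure_bounded_finite[of "cball (0::'a) (B + norm e)"] by (simp add: ennreal_mult_less_top)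
    finally show "(\<integral>\<^sup>+ x. ennreal ((L * norm e)\<^sup>2) * indicator (cball (0::'a) (B + norm e)) x \<partial>lborel) < \<infinity>" .
    show "AE x in lborel. (\<lambda>k. ennreal ((?q k x)\<^sup>2)) \<longlonglongrightarrow> ennreal ((dir_deriv u e x)\<^sup>2)"
      using AE_DERIV_dir_deriv[OF lip, of e]
      by eventually_elim (intro tendsto_ennrealI tendsto_power dir_deriv_tendsto)
  qed measurable
  moreover have "shift_energy u e \<le> (\<integral>\<^sup>+ x. ennreal ((?q k x)\<^sup>2) \<partial>lborel)" for k
  proof -
    have "shift_energy u (real (Suc k) *\<^sub>R ((1 / real (Suc k)) *\<^sub>R e))
        \<le> ennreal ((real (Suc k))\<^sup>2) * shift_energy u ((1 / real (Suc k)) *\<^sub>R e)"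
      by (rule shift_energy_multiple) measurable
    also have "\<dots> = (\<integral>\<^sup>+ x. ennreal ((?q k x)\<^sup>2) \<partial>lborel)"
      unfolding shift_energy_def power_mult_distrib by (subst nn_integral_cmult[symmetric]) (auto simp: ennreal_mult)
    finally show ?thesis by simp
  qed
  ultimately show ?thesis by (intro LIMSEQ_le_const) auto
qed

lemma dir_deriv_scaleR_AE:
  fixes u :: "'a::euclidean_space \<Rightarrow> real"
  assumes "L-lipschitz_on UNIV u"
  shows "AE x in lborel. dir_deriv u (c *\<^sub>R e) x = c * dir_deriv u e x"
  using AE_DERIV_dir_deriv[OF assms, of e]
proof eventually_elim
  case (elim x)
  have "DERIV (\<lambda>t. c * t) 0 :> c" by (rule derivative_eq_intros refl | simp)+
  then have "DERIV (\<lambda>t. u (x + (c * t) *\<^sub>R e)) 0 :> dir_deriv u e x * c"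
    using DERIV_chain2[of "\<lambda>t. u (x + t *\<^sub>R e)" "dir_deriv u e x" "\<lambda>t. c * t" 0 c UNIV] elim by simp
  then show ?case by (intro dir_deriv_eq) (simp add: mult.commute)
qed

text \<open>Move along one coordinate axis at a time. Each move costs at most
  \<open>\<rho>\<^sup>2\<close> times the energy, and the factors 2 from
  \<open>shift_energy_add\<close> accumulate to the crude constant
  \<open>4 ^ CARD('n)\<close>.\<close>

lemma shift_energy_le_dirichlet:
  fixes u :: "real ^ 'n \<Rightarrow> real"
  assumes lip: "L-lipschitz_on UNIV u" and supp: "\<And>x. u x \<noteq> 0 \<Longrightarrow> norm x \<le> B"
    and h: "norm h \<le> \<rho>"
  shows "shift_energy u h \<le> ennreal (4 ^ CARD('n) * \<rho>\<^sup>2) * dirichlet_energy u"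
proof -
  have [measurable]: "u \<in> borel_measurable borel" by (rule borel_measurable_lipschitz[OF lip])
  have one: "shift_energy u (h $ i *\<^sub>R axis i 1) \<le> ennreal (\<rho>\<^sup>2) * dirichlet_energy u" for i
  proof -
    have "shift_energy u (h $ i *\<^sub>R axis i 1) \<le> (\<integral>\<^sup>+ x. ennreal ((dir_deriv u (h $ i *\<^sub>R axis i 1) x)\<^sup>2) \<partial>lborel)"
      by (rule shift_energy_le_dir_deriv[OF lip supp])
    also have "\<dots> \<le> (\<integral>\<^sup>+ x. ennreal (\<rho>\<^sup>2) * ennreal (grad_sq u x) \<partial>lborel)"
    proof (rule nn_integral_mono_AE)
      show "AE x in lborel. ennreal ((dir_deriv u (h $ i *\<^sub>R axis i 1) x)\<^sup>2) \<le> ennreal (\<rho>\<^sup>2) * ennreal (grad_sq u x)"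
        using dir_deriv_scaleR_AE[OF lip, of "h $ i" "axis i 1"]
      proof eventually_elim
        case (elim x)
        have "\<bar>h $ i\<bar> \<le> \<rho>" using h component_le_norm_cart[of h i] by linarith
        then have "(h $ i)\<^sup>2 \<le> \<rho>\<^sup>2" by (metis abs_ge_zero power2_abs power_mono)
        moreover have "(dir_deriv u (axis i 1) x)\<^sup>2 \<le> grad_sq u x"
          unfolding grad_sq_def by (rule member_le_sum) auto
        ultimately have "(dir_deriv u (h $ i *\<^sub>R axis i 1) x)\<^sup>2 \<le> \<rho>\<^sup>2 * grad_sq u x"
          unfolding elim power_mult_distrib by (intro mult_mono) auto
        then show ?case by (simp add: ennreal_mult[symmetric] grad_sq_nonneg ennreal_leI)
      qed
    qed
    also have "\<dots> = ennreal (\<rho>\<^sup>2) * dirichlet_energy u"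
      by (simp add: nn_integral_cmult dirichlet_energy_eq[OF lip])
    finally show ?thesis .
  qed
  have "shift_energy u (\<Sum>i\<in>I. h $ i *\<^sub>R axis i 1) \<le> ennreal (4 ^ card I) * (ennreal (\<rho>\<^sup>2) * dirichlet_energy u)"
    if "finite I" for I :: "'n set"
    using that
  proof induction
    case empty
    show ?case by (simp add: shift_energy_def)
  next
    case (insert i I)
    let ?D = "ennreal (\<rho>\<^sup>2) * dirichlet_energy u"
    have "shift_energy u (\<Sum>i\<in>insert i I. h $ i *\<^sub>R axis i 1)
        \<le> 2 * shift_energy u (h $ i *\<^sub>R axis i 1) + 2 * shift_energy u (\<Sum>i\<in>I. h $ i *\<^sub>R axis i 1)"
      using insert by (simp add: shift_energy_add)
    also have "\<dots> \<le> 2 * ?D + 2 * (ennreal (4 ^ card I) * ?D)"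
      by (intro add_mono mult_left_mono one insert) auto
    also have "\<dots> = ennreal (2 + 2 * 4 ^ card I) * ?D"
      by (simp add: ennreal_plus ennreal_mult distrib_right mult.assoc)
    \<comment> \<open>Since \<open>1 \<le> 4 ^ card I\<close>, the summand 2 is absorbed by a second
      doubling; this is why the base is 4.\<close>
    also have "\<dots> \<le> ennreal (4 * 4 ^ card I) * ?D"
      using one_le_power[of "4::real" "card I"] by (intro mult_right_mono ennreal_leI) auto
    also have "\<dots> = ennreal (4 ^ card (insert i I)) * ?D" using insert by simp
    finally show ?case .
  qed
  from this[of UNIV] show ?thesis
    using basis_expansion[of h] by (simp add: scalar_mult_eq_scaleR ennreal_mult mult.assoc)
qed

section \<open>Capacity and cutoff functions\<close>

lemma abs_dir_deriv_le:
  fixes \<eta> :: "'a::real_normed_vector \<Rightarrow> real"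
  assumes lip: "K-lipschitz_on UNIV \<eta>" and D: "DERIV (\<lambda>t. \<eta> (x + t *\<^sub>R e)) 0 :> D"
  shows "\<bar>D\<bar> \<le> K * norm e"
proof (rule LIMSEQ_le_const2[OF tendsto_rabs[OF dir_deriv_tendsto[OF D]]], intro exI allI impI)
  fix k :: nat
  have "\<bar>\<eta> (x + (1 / real (Suc k)) *\<^sub>R e) - \<eta> x\<bar> \<le> K * norm ((1 / real (Suc k)) *\<^sub>R e)"
    using lipschitz_onD[OF lip, of "x + (1 / real (Suc k)) *\<^sub>R e" x] by (simp add: dist_norm)
  then show "\<bar>real (Suc k) * (\<eta> (x + (1 / real (Suc k)) *\<^sub>R e) - \<eta> x)\<bar> \<le> K * norm e"
    by (simp add: abs_mult divide_simps mult_ac)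
qed

text \<open>The complement of \<open>S\<close> is open, so the difference quotients along the
  sequence \<open>1 / Suc k\<close> are eventually zero. This confines the gradient of a cutoff to
  its supporting ball.\<close>

lemma dir_deriv_zero_if_outside:
  fixes \<eta> :: "'a::real_normed_vector \<Rightarrow> real"
  assumes zero: "\<And>x. x \<notin> S \<Longrightarrow> \<eta> x = 0" and "closed S" "x \<notin> S"
    and D: "DERIV (\<lambda>t. \<eta> (x + t *\<^sub>R e)) 0 :> D"
  shows "D = 0"
proof -
  have "(\<lambda>k. x + (1 / real (Suc k)) *\<^sub>R e) \<longlonglongrightarrow> x + 0 *\<^sub>R e"
    by (intro tendsto_intros lim_1_over_n[THEN LIMSEQ_Suc])
  then have "\<forall>\<^sub>F k in sequentially. x + (1 / real (Suc k)) *\<^sub>R e \<in> - S"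
    using assms by (intro topological_tendstoD) auto
  then have "\<forall>\<^sub>F k in sequentially. real (Suc k) * (\<eta> (x + (1 / real (Suc k)) *\<^sub>R e) - \<eta> x) = 0"
    by eventually_elim (use assms in auto)
  then have "(\<lambda>k. real (Suc k) * (\<eta> (x + (1 / real (Suc k)) *\<^sub>R e) - \<eta> x)) \<longlonglongrightarrow> 0"
    by (rule tendsto_eventually)
  then show ?thesis using LIMSEQ_unique[OF dir_deriv_tendsto[OF D]] by simp
qed

lemma square_add_le_weighted:
  fixes a b \<epsilon> :: real
  assumes "\<epsilon> > 0"
  shows "(a + b)\<^sup>2 \<le> (1 + \<epsilon>) * a\<^sup>2 + (1 + 1 / \<epsilon>) * b\<^sup>2"
proof -
  have "0 \<le> (\<epsilon> * a - b)\<^sup>2 / \<epsilon>" using assms by simp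
  also have "\<dots> = \<epsilon> * a\<^sup>2 + (1 / \<epsilon>) * b\<^sup>2 - 2 * a * b"
    using assms by (simp add: field_simps power2_eq_square)
  finally show ?thesis by (simp add: algebra_simps power2_eq_square)
qed

text \<open>One form for the two test functions used below: \<open>b = 0\<close>,
  \<open>s = 1 / (1 - u a)\<close>, \<open>c = u a\<close> localises \<open>u\<close> near
  \<open>a\<close>, and \<open>b = 1\<close>, \<open>s = - 1\<close>, \<open>c = 1\<close> raises
  \<open>u\<close> to 1. The product rule separates the gradients of \<open>u\<close> and
  \<open>\<eta>\<close>, and the weighted square allows a constant close to 1 on the former. The
  factor \<open>CARD('n)\<close> comes from bounding each partial derivative of
  \<open>\<eta>\<close> by \<open>K\<close>.\<close>

lemma grad_sq_cutoff_AE: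
  fixes u \<eta> :: "real ^ 'n \<Rightarrow> real"
  assumes u: "L-lipschitz_on UNIV u" and \<eta>: "K-lipschitz_on UNIV \<eta>"
    and supp: "\<And>x. x \<notin> cball z \<rho> \<Longrightarrow> \<eta> x = 0" and \<epsilon>: "\<epsilon> > 0"
  shows "AE x in lborel. grad_sq (\<lambda>x. b * u x + s * (\<eta> x * (u x - c))) x
     \<le> (1 + \<epsilon>) * (b + s * \<eta> x)\<^sup>2 * grad_sq u x
       + (1 + 1 / \<epsilon>) * (s\<^sup>2 * CARD('n) * K\<^sup>2) * ((u x - c)\<^sup>2 * indicator (cball z \<rho>) x)"
proof -
  have "AE x in lborel. \<forall>i. DERIV (\<lambda>t. u (x + t *\<^sub>R axis i 1)) 0 :> dir_deriv u (axis i 1) x"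
       "AE x in lborel. \<forall>i. DERIV (\<lambda>t. \<eta> (x + t *\<^sub>R axis i 1)) 0 :> dir_deriv \<eta> (axis i 1) x"
    by (simp_all add: AE_all_countable AE_DERIV_dir_deriv[OF u] AE_DERIV_dir_deriv[OF \<eta>])
  then show ?thesis
  proof eventually_elim
    case (elim x)
    let ?I = "indicator (cball z \<rho>) x :: real"
    have "(dir_deriv (\<lambda>x. b * u x + s * (\<eta> x * (u x - c))) (axis i 1) x)\<^sup>2
       \<le> (1 + \<epsilon>) * (b + s * \<eta> x)\<^sup>2 * (dir_deriv u (axis i 1) x)\<^sup>2 + (1 + 1 / \<epsilon>) * (s\<^sup>2 * K\<^sup>2) * ((u x - c)\<^sup>2 * ?I)" for i :: 'n
    proof -
      let ?D = "dir_deriv u (axis i 1) x" and ?E = "dir_deriv \<eta> (axis i 1) x"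
      have D: "DERIV (\<lambda>t. u (x + t *\<^sub>R axis i 1)) 0 :> ?D" and E: "DERIV (\<lambda>t. \<eta> (x + t *\<^sub>R axis i 1)) 0 :> ?E"
        using elim by auto
      have "DERIV (\<lambda>t. b * u (x + t *\<^sub>R axis i 1) + s * (\<eta> (x + t *\<^sub>R axis i 1) * (u (x + t *\<^sub>R axis i 1) - c))) 0
          :> (b + s * \<eta> x) * ?D + s * (u x - c) * ?E"
        by (rule derivative_eq_intros D E refl | simp add: algebra_simps)+
      then have dir_deriv: "dir_deriv (\<lambda>x. b * u x + s * (\<eta> x * (u x - c))) (axis i 1) x = (b + s * \<eta> x) * ?D + s * (u x - c) * ?E"
        by (rule dir_deriv_eq)
      have "?E\<^sup>2 \<le> K\<^sup>2 * ?I"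
      proof (cases "x \<in> cball z \<rho>")
        case True
        have "\<bar>?E\<bar> \<le> K" using abs_dir_deriv_le[OF \<eta> E] by simp
        then have "?E\<^sup>2 \<le> K\<^sup>2" by (metis abs_ge_zero power2_abs power_mono)
        then show ?thesis using True by simp
      next
        case False
        have "?E = 0" by (rule dir_deriv_zero_if_outside[OF supp closed_cball False E])
        then show ?thesis by simp
      qed
      have "(s * (u x - c) * ?E)\<^sup>2 = (s\<^sup>2 * (u x - c)\<^sup>2) * ?E\<^sup>2" by (simp add: power_mult_distrib)
      also have "\<dots> \<le> (s\<^sup>2 * (u x - c)\<^sup>2) * (K\<^sup>2 * ?I)"
        by (rule mult_left_mono[OF \<open>?E\<^sup>2 \<le> K\<^sup>2 * ?I\<close>]) simp
      finally have "(1 + 1 / \<epsilon>) * (s * (u x - c) * ?E)\<^sup>2 \<le> (1 + 1 / \<epsilon>) * ((s\<^sup>2 * (u x - c)\<^sup>2) * (K\<^sup>2 * ?I))"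
        using \<epsilon> by (intro mult_left_mono) auto
      with square_add_le_weighted[OF \<epsilon>, of "(b + s * \<eta> x) * ?D" "s * (u x - c) * ?E"]
      show ?thesis unfolding dir_deriv by (simp add: power_mult_distrib mult_ac)
    qed
    then have "grad_sq (\<lambda>x. b * u x + s * (\<eta> x * (u x - c))) x
       \<le> (\<Sum>i\<in>(UNIV :: 'n set). (1 + \<epsilon>) * (b + s * \<eta> x)\<^sup>2 * (dir_deriv u (axis i 1) x)\<^sup>2 + (1 + 1 / \<epsilon>) * (s\<^sup>2 * K\<^sup>2) * ((u x - c)\<^sup>2 * ?I))"
      unfolding grad_sq_def by (intro sum_mono)
    also have "\<dots> = (1 + \<epsilon>) * (b + s * \<eta> x)\<^sup>2 * grad_sq u x
       + (1 + 1 / \<epsilon>) * (s\<^sup>2 * CARD('n) * K\<^sup>2) * ((u x - c)\<^sup>2 * ?I)"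
      unfolding sum.distrib grad_sq_def sum_distrib_left[symmetric] by (simp add: mult_ac)
    finally show ?case .
  qed
qed

lemma lipschitz_on_mult_bounded:
  fixes f g :: "'a::metric_space \<Rightarrow> real"
  assumes f: "A-lipschitz_on X f" and g: "B-lipschitz_on X g"
    and fb: "\<And>x. x \<in> X \<Longrightarrow> \<bar>f x\<bar> \<le> M" and gb: "\<And>x. x \<in> X \<Longrightarrow> \<bar>g x\<bar> \<le> N"
    and "0 \<le> M" "0 \<le> N"
  shows "(M * B + N * A)-lipschitz_on X (\<lambda>x. f x * g x)"
proof (rule lipschitz_onI)
  fix x y assume xy: "x \<in> X" "y \<in> X"
  have "dist (f x * g x) (f y * g y) = \<bar>f x * (g x - g y) + g y * (f x - f y)\<bar>"
    by (simp add: dist_real_def algebra_simps)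
  also have "\<dots> \<le> \<bar>f x\<bar> * \<bar>g x - g y\<bar> + \<bar>g y\<bar> * \<bar>f x - f y\<bar>"
    by (metis abs_mult abs_triangle_ineq)
  also have "\<dots> \<le> M * (B * dist x y) + N * (A * dist x y)"
    using lipschitz_onD[OF f xy] lipschitz_onD[OF g xy] xy assms
    by (intro add_mono mult_mono) (auto simp: dist_real_def)
  finally show "dist (f x * g x) (f y * g y) \<le> (M * B + N * A) * dist x y" by (simp add: algebra_simps)
qed (use assms lipschitz_on_nonneg[OF f] lipschitz_on_nonneg[OF g] in auto)

section \<open>Admissible functions and the capacity of balls\<close>

lemma mem_cap_admissible:
  "u \<in> cap_admissible F \<longleftrightarrow> (\<exists>L. L-lipschitz_on UNIV u) \<and> bounded {x. u x \<noteq> 0} \<and> (\<forall>x\<in>F. u x = 1)"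
  by (simp add: cap_admissible_def compact_closure)

lemma wiener_cap_le: "u \<in> cap_admissible F \<Longrightarrow> wiener_cap F \<le> dirichlet_energy u"
  unfolding wiener_cap_def dirichlet_energy_def by (rule INF_lower)

lemma wiener_cap_greatest:
  "(\<And>u. u \<in> cap_admissible F \<Longrightarrow> c \<le> dirichlet_energy u) \<Longrightarrow> c \<le> wiener_cap F"
  unfolding wiener_cap_def dirichlet_energy_def by (rule INF_greatest)

lemma wiener_cap_mono: "F \<subseteq> G \<Longrightarrow> wiener_cap F \<le> wiener_cap G"
  by (intro wiener_cap_greatest wiener_cap_le) (auto simp: mem_cap_admissible)

definition cutoff :: "'a::metric_space \<Rightarrow> real \<Rightarrow> real \<Rightarrow> 'a \<Rightarrow> real" where
  "cutoff z \<rho>\<^sub>1 \<rho>\<^sub>2 x = max 0 (min 1 ((\<rho>\<^sub>2 - dist z x) / (\<rho>\<^sub>2 - \<rho>\<^sub>1)))"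

lemma cutoff_bounds: "0 \<le> cutoff z \<rho>\<^sub>1 \<rho>\<^sub>2 x" "cutoff z \<rho>\<^sub>1 \<rho>\<^sub>2 x \<le> 1"
  by (auto simp: cutoff_def)

lemma cutoff_eq_1: "\<rho>\<^sub>1 < \<rho>\<^sub>2 \<Longrightarrow> x \<in> cball z \<rho>\<^sub>1 \<Longrightarrow> cutoff z \<rho>\<^sub>1 \<rho>\<^sub>2 x = 1"
  by (auto simp: cutoff_def min_def field_simps)

lemma cutoff_eq_0: "\<rho>\<^sub>1 < \<rho>\<^sub>2 \<Longrightarrow> x \<notin> cball z \<rho>\<^sub>2 \<Longrightarrow> cutoff z \<rho>\<^sub>1 \<rho>\<^sub>2 x = 0"
  by (auto simp: cutoff_def max_def min_def field_simps)

lemma lipschitz_cutoff: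
  assumes "\<rho>\<^sub>1 < \<rho>\<^sub>2"
  shows "(1 / (\<rho>\<^sub>2 - \<rho>\<^sub>1))-lipschitz_on UNIV (cutoff z \<rho>\<^sub>1 \<rho>\<^sub>2)"
proof (rule lipschitz_onI)
  fix x y
  have clip: "\<bar>max 0 (min 1 a) - max 0 (min 1 b)\<bar> \<le> \<bar>a - b\<bar>" for a b :: real by linarith
  have "dist (cutoff z \<rho>\<^sub>1 \<rho>\<^sub>2 x) (cutoff z \<rho>\<^sub>1 \<rho>\<^sub>2 y) \<le> \<bar>(\<rho>\<^sub>2 - dist z x) / (\<rho>\<^sub>2 - \<rho>\<^sub>1) - (\<rho>\<^sub>2 - dist z y) / (\<rho>\<^sub>2 - \<rho>\<^sub>1)\<bar>"
    unfolding cutoff_def dist_real_def by (rule clip)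
  also have "\<dots> = \<bar>dist z y - dist z x\<bar> / (\<rho>\<^sub>2 - \<rho>\<^sub>1)"
    using assms by (simp add: diff_divide_distrib[symmetric])
  also have "\<dots> \<le> dist x y / (\<rho>\<^sub>2 - \<rho>\<^sub>1)"
    using assms abs_dist_diff_le[of y z x] by (intro divide_right_mono) (auto simp: dist_commute)
  finally show "dist (cutoff z \<rho>\<^sub>1 \<rho>\<^sub>2 x) (cutoff z \<rho>\<^sub>1 \<rho>\<^sub>2 y) \<le> 1 / (\<rho>\<^sub>2 - \<rho>\<^sub>1) * dist x y" by simp
qed (use assms in simp)

text \<open>The cutoff between the radii \<open>r\<close> and \<open>2 * r\<close> is a test
  function whose gradient is bounded and vanishes off the larger ball.\<close>

lemma wiener_cap_cball_finite:
  fixes z :: "real ^ 'n"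
  assumes "0 < r"
  shows "wiener_cap (cball z r) < \<infinity>"
proof -
  let ?\<eta> = "cutoff z r (2 * r)" and ?K = "1 / (2 * r - r)"
  have r: "r < 2 * r" using assms by simp
  have lip: "?K-lipschitz_on UNIV ?\<eta>" by (rule lipschitz_cutoff[OF r])
  have "{x. ?\<eta> x \<noteq> 0} \<subseteq> cball z (2 * r)" using cutoff_eq_0[OF r] by blast
  then have "bounded {x. ?\<eta> x \<noteq> 0}" by (rule bounded_subset[OF bounded_cball])
  then have "?\<eta> \<in> cap_admissible (cball z r)"
    using lip by (auto simp: mem_cap_admissible cutoff_eq_1[OF r])
  then have "wiener_cap (cball z r) \<le> dirichlet_energy ?\<eta>" by (rule wiener_cap_le)
  also have "\<dots> = (\<integral>\<^sup>+ x. ennreal (grad_sq ?\<eta> x) \<partial>lborel)" by (rule dirichlet_energy_eq[OF lip])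
  also have "\<dots> \<le> (\<integral>\<^sup>+ x. ennreal (CARD('n) * ?K\<^sup>2) * indicator (cball z (2 * r)) x \<partial>lborel)"
  proof (rule nn_integral_mono_AE)
    have "AE x in lborel. \<forall>i. DERIV (\<lambda>t. ?\<eta> (x + t *\<^sub>R axis i 1)) 0 :> dir_deriv ?\<eta> (axis i 1) x"
      by (simp add: AE_all_countable AE_DERIV_dir_deriv[OF lip])
    then show "AE x in lborel. ennreal (grad_sq ?\<eta> x) \<le> ennreal (CARD('n) * ?K\<^sup>2) * indicator (cball z (2 * r)) x"
    proof eventually_elim
      case (elim x)
      show ?case
      proof (cases "x \<in> cball z (2 * r)")
        case True
        have "(dir_deriv ?\<eta> (axis i 1) x)\<^sup>2 \<le> ?K\<^sup>2" for i
          using abs_dir_deriv_le[OF lip elim[rule_format, of i]] by (metis abs_ge_zero mult.right_neutral norm_axis_1 power2_abs power_mono)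
        then have "grad_sq ?\<eta> x \<le> CARD('n) * ?K\<^sup>2"
          unfolding grad_sq_def by (rule sum_bounded_above)
        then show ?thesis using True by (simp add: ennreal_leI)
      next
        case False
        have "dir_deriv ?\<eta> (axis i 1) x = 0" for i
          by (rule dir_deriv_zero_if_outside[OF _ closed_cball False elim[rule_format, of i]]) (rule cutoff_eq_0[OF r])
        then show ?thesis by (simp add: grad_sq_def)
      qed
    qed
  qed
  also have "\<dots> = ennreal (CARD('n) * ?K\<^sup>2) * emeasure lborel (cball z (2 * r))"
    by (rule nn_integral_cmult_indicator) simp
  also have "\<dots> < \<infinity>"
    using emeasure_bounded_finite[of "cball z (2 * r)"] by (simp add: ennreal_mult_less_top)
  finally show ?thesis .
qed

text \<open>Pull a test function back under \<open>x \<mapsto> w + t *\<^sub>R x\<close>. The chain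
  rule gives a factor \<open>t\<^sup>2\<close> and the change of variables divides by
  \<open>t ^ CARD('n)\<close>.\<close>

lemma wiener_cap_homothety:
  fixes a b :: "real ^ 'n"
  assumes t: "0 < t" and n: "2 \<le> CARD('n)"
  shows "ennreal (t ^ (CARD('n) - 2)) * wiener_cap (cball a r) \<le> wiener_cap (cball b (t * r))"
proof (rule wiener_cap_greatest)
  fix v assume v: "v \<in> cap_admissible (cball b (t * r))"
  then obtain L where L: "L-lipschitz_on UNIV v" and bd: "bounded {x. v x \<noteq> 0}" and one: "\<And>x. x \<in> cball b (t * r) \<Longrightarrow> v x = 1"
    by (auto simp: mem_cap_admissible)
  have [measurable]: "v \<in> borel_measurable borel" by (rule borel_measurable_lipschitz[OF L])
  \<comment> \<open>Chosen so that the dilation maps \<open>a\<close> to \<open>b\<close>, hence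
    \<open>cball a r\<close> onto \<open>cball b (t * r)\<close>.\<close>
  define w where "w = b - t *\<^sub>R a"
  define u where "u = (\<lambda>x. v (w + t *\<^sub>R x))"
  have lip: "(L * t)-lipschitz_on UNIV u"
  proof (rule lipschitz_onI)
    fix x y
    have "dist (u x) (u y) \<le> L * dist (w + t *\<^sub>R x) (w + t *\<^sub>R y)"
      unfolding u_def by (rule lipschitz_onD[OF L]) auto
    also have "dist (w + t *\<^sub>R x) (w + t *\<^sub>R y) = t * dist x y"
      using t by (simp add: dist_norm scaleR_diff_right[symmetric])
    finally show "dist (u x) (u y) \<le> L * t * dist x y" by simp
  qed (use t lipschitz_on_nonneg[OF L] in simp)
  have "u \<in> cap_admissible (cball a r)"
    unfolding mem_cap_admissible
  proof (intro conjI ballI)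
    have "{x. u x \<noteq> 0} \<subseteq> (\<lambda>y. (1 / t) *\<^sub>R (y - w)) ` {x. v x \<noteq> 0}"
    proof
      fix x assume "x \<in> {x. u x \<noteq> 0}"
      then show "x \<in> (\<lambda>y. (1 / t) *\<^sub>R (y - w)) ` {x. v x \<noteq> 0}"
        using t by (intro image_eqI[of _ _ "w + t *\<^sub>R x"]) (auto simp: u_def)
    qed
    moreover have "bounded ((\<lambda>y. (1 / t) *\<^sub>R (y - w)) ` {x. v x \<noteq> 0})"
      using bounded_scaling[OF bounded_translation_minus[OF bd, of w], of "1 / t"]
      by (simp add: image_image)
    ultimately show "bounded {x. u x \<noteq> 0}" by (rule bounded_subset[rotated])
    fix x assume "x \<in> cball a r"
    moreover have "b - (w + t *\<^sub>R x) = t *\<^sub>R (a - x)" by (simp add: w_def algebra_simps)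
    ultimately show "u x = 1"
      unfolding u_def using t by (intro one) (simp add: dist_norm)
  qed (use lip in blast)
  then have "wiener_cap (cball a r) \<le> dirichlet_energy u" by (rule wiener_cap_le)
  \<comment> \<open>An identity at every point: both sides are \<open>lim\<close> of the same
    sequence.\<close>
  moreover have "dir_deriv u e x = dir_deriv v (t *\<^sub>R e) (w + t *\<^sub>R x)" for e x
    by (simp add: dir_deriv_def u_def scaleR_add_right add.assoc)
  ultimately have "wiener_cap (cball a r) \<le> (\<integral>\<^sup>+ x. ennreal (\<Sum>i\<in>UNIV. (dir_deriv v (t *\<^sub>R axis i 1) (w + t *\<^sub>R x))\<^sup>2) \<partial>lborel)"
    by (simp add: dirichlet_energy_eq[OF lip] grad_sq_def)
  then have "ennreal (t ^ CARD('n)) * wiener_cap (cball a r)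
     \<le> ennreal (t ^ CARD('n)) * (\<integral>\<^sup>+ x. ennreal (\<Sum>i\<in>UNIV. (dir_deriv v (t *\<^sub>R axis i 1) (w + t *\<^sub>R x))\<^sup>2) \<partial>lborel)"
    by (rule mult_left_mono) simp
  \<comment> \<open>The factor \<open>t ^ CARD('n)\<close> is the Jacobian of the dilation.\<close>
  also have "\<dots> = (\<integral>\<^sup>+ x. ennreal (\<Sum>i\<in>UNIV. (dir_deriv v (t *\<^sub>R axis i 1) x)\<^sup>2) \<partial>lborel)"
    using t by (subst (2) lborel_affine[of t w]) (auto simp: nn_integral_density nn_integral_distr nn_integral_cmult)
  also have "\<dots> = (\<integral>\<^sup>+ x. ennreal (t\<^sup>2) * ennreal (grad_sq v x) \<partial>lborel)"
  proof (rule nn_integral_cong_AE)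
    have "AE x in lborel. \<forall>i. dir_deriv v (t *\<^sub>R axis i 1) x = t * dir_deriv v (axis i 1) x"
      by (simp add: AE_all_countable dir_deriv_scaleR_AE[OF L])
    then show "AE x in lborel. ennreal (\<Sum>i\<in>UNIV. (dir_deriv v (t *\<^sub>R axis i 1) x)\<^sup>2) = ennreal (t\<^sup>2) * ennreal (grad_sq v x)"
      by eventually_elim (simp add: ennreal_mult[symmetric] grad_sq_nonneg,
        simp add: grad_sq_def power_mult_distrib sum_distrib_left)
  qed
  also have "\<dots> = ennreal (t\<^sup>2) * dirichlet_energy v"
    by (simp add: nn_integral_cmult dirichlet_energy_eq[OF L])
  finally have "ennreal (1 / t\<^sup>2) * (ennreal (t ^ CARD('n)) * wiener_cap (cball a r))
     \<le> ennreal (1 / t\<^sup>2) * (ennreal (t\<^sup>2) * dirichlet_energy v)"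
    by (rule mult_left_mono) simp
  moreover have "1 / t\<^sup>2 * t ^ CARD('n) = t ^ (CARD('n) - 2)"
    using t n by (simp add: power_diff)
  ultimately show "ennreal (t ^ (CARD('n) - 2)) * wiener_cap (cball a r) \<le> dirichlet_energy v"
    using t by (simp add: mult.assoc[symmetric] ennreal_mult[symmetric])
qed

section \<open>Capacity and the deviation of a test function from one\<close>

text \<open>A Lipschitz function with bounded support is bounded, so its product with the bounded
  Lipschitz function \<open>\<eta>\<close> is again Lipschitz.\<close>

lemma cap_admissible_cutoff:
  fixes u \<eta> :: "real ^ 'n \<Rightarrow> real"
  assumes u: "L-lipschitz_on UNIV u" and bd: "bounded {x. u x \<noteq> 0}"
    and \<eta>: "K-lipschitz_on UNIV \<eta>" "\<And>x. 0 \<le> \<eta> x" "\<And>x. \<eta> x \<le> 1" "\<And>x. x \<notin> cball z \<rho> \<Longrightarrow> \<eta> x = 0"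
    and one: "\<And>x. x \<in> F \<Longrightarrow> b * u x + s * (\<eta> x * (u x - c)) = 1"
  shows "(\<lambda>x. b * u x + s * (\<eta> x * (u x - c))) \<in> cap_admissible F"
  unfolding mem_cap_admissible
proof (intro conjI ballI)
  have "compact (u ` closure {x. u x \<noteq> 0})"
    using bd by (intro compact_continuous_image continuous_on_subset[OF lipschitz_on_continuous_on[OF u]])
      (auto simp: compact_closure)
  then have "bounded (u ` closure {x. u x \<noteq> 0})" by (rule compact_imp_bounded)
  then obtain M where M: "M > 0" "\<And>x. x \<in> closure {x. u x \<noteq> 0} \<Longrightarrow> \<bar>u x\<bar> \<le> M"
    by (auto simp: bounded_pos)
  have uM: "\<bar>u x\<bar> \<le> M" for x
    using M closure_subset[of "{x. u x \<noteq> 0}"] by (cases "u x = 0") auto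
  have "(1 * (L + 0) + (M + \<bar>c\<bar>) * K)-lipschitz_on UNIV (\<lambda>x. \<eta> x * (u x - c))"
  proof (rule lipschitz_on_mult_bounded)
    show "(L + 0)-lipschitz_on UNIV (\<lambda>x. u x - c)" by (intro lipschitz_on_diff u lipschitz_on_constant)
    show "\<bar>u x - c\<bar> \<le> M + \<bar>c\<bar>" for x using uM[of x] by linarith
    show "\<bar>\<eta> x\<bar> \<le> 1" for x using \<eta>(2,3)[of x] by simp
  qed (use \<eta>(1) M(1) in auto)
  from lipschitz_on_add[OF lipschitz_on_cmult_real[OF u, of b] lipschitz_on_cmult_real[OF this, of s]]
  show "\<exists>L. L-lipschitz_on UNIV (\<lambda>x. b * u x + s * (\<eta> x * (u x - c)))" by blast
  have "{x. b * u x + s * (\<eta> x * (u x - c)) \<noteq> 0} \<subseteq> {x. u x \<noteq> 0} \<union> cball z \<rho>"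
    using \<eta>(4) by auto
  then show "bounded {x. b * u x + s * (\<eta> x * (u x - c)) \<noteq> 0}"
    using bd by (meson bounded_Un bounded_cball bounded_subset)
qed (rule one)

text \<open>The function \<open>(u - u a) / (1 - u a)\<close> equals 1 on \<open>F\<close>.
  Multiplied by the cutoff between the radii \<open>r\<close> and \<open>2 * r\<close> about
  \<open>a\<close>, it tests the capacity of \<open>F \<inter> cball a r\<close>; clearing the
  denominator gives the factor \<open>(u a - 1)\<^sup>2\<close>.\<close>

lemma capacity_pointwise_bound:
  fixes u :: "real ^ 'n \<Rightarrow> real"
  assumes u: "u \<in> cap_admissible F" and r: "0 < r" and \<kappa>: "0 \<le> \<kappa>" "ennreal \<kappa> \<le> wiener_cap (F \<inter> cball a r)"
  shows "ennreal (\<kappa> * (u a - 1)\<^sup>2) \<le> (\<integral>\<^sup>+ x. ennreal (2 * grad_sq u x + 2 * (CARD('n) * (1 / r)\<^sup>2) * (u x - u a)\<^sup>2)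
     * indicator (cball a (2 * r)) x \<partial>lborel)"
proof (cases "u a = 1")
  case False
  obtain L where L: "L-lipschitz_on UNIV u" and bd: "bounded {x. u x \<noteq> 0}" and one: "\<And>x. x \<in> F \<Longrightarrow> u x = 1"
    using u by (auto simp: mem_cap_admissible)
  have [measurable]: "u \<in> borel_measurable borel" by (rule borel_measurable_lipschitz[OF L])
  let ?\<eta> = "cutoff a r (2 * r)"
  define s where "s = 1 / (1 - u a)"
  define v where "v = (\<lambda>x. 0 * u x + s * (?\<eta> x * (u x - u a)))"
  have r2: "r < 2 * r" using r by simp
  have [measurable]: "cball a (2 * r) \<in> sets borel" by simp
  have \<eta>: "(1 / r)-lipschitz_on UNIV ?\<eta>" using lipschitz_cutoff[OF r2] by simp
  have "v \<in> cap_admissible (F \<inter> cball a r)"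
    unfolding v_def
  proof (rule cap_admissible_cutoff[OF L bd \<eta> cutoff_bounds cutoff_eq_0[OF r2]])
    fix x assume x: "x \<in> F \<inter> cball a r"
    then show "0 * u x + s * (?\<eta> x * (u x - u a)) = 1"
      using cutoff_eq_1[OF r2, of x a] one[of x] False by (simp add: s_def)
  qed
  then obtain Lv where Lv: "Lv-lipschitz_on UNIV v" and cap: "wiener_cap (F \<inter> cball a r) \<le> dirichlet_energy v"
    using wiener_cap_le by (auto simp: mem_cap_admissible)
  let ?f = "\<lambda>x. ennreal (2 * grad_sq u x + 2 * (CARD('n) * (1 / r)\<^sup>2) * (u x - u a)\<^sup>2) * indicator (cball a (2 * r)) x"
  have "dirichlet_energy v = (\<integral>\<^sup>+ x. ennreal (grad_sq v x) \<partial>lborel)" by (rule dirichlet_energy_eq[OF Lv])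
  also have "\<dots> \<le> (\<integral>\<^sup>+ x. ennreal (s\<^sup>2) * ?f x \<partial>lborel)"
  proof (rule nn_integral_mono_AE)
    \<comment> \<open>The weight is \<open>\<epsilon> = 1\<close>, whence both constants 2; only
      \<open>capacity_Poincare\<close> uses the result, where constants need not be sharp.\<close>
    have "AE x in lborel. grad_sq v x \<le> (1 + 1) * (0 + s * ?\<eta> x)\<^sup>2 * grad_sq u x
       + (1 + 1 / 1) * (s\<^sup>2 * CARD('n) * (1 / r)\<^sup>2) * ((u x - u a)\<^sup>2 * indicator (cball a (2 * r)) x)"
      unfolding v_def by (rule grad_sq_cutoff_AE[OF L \<eta> cutoff_eq_0[OF r2]]) auto
    then show "AE x in lborel. ennreal (grad_sq v x) \<le> ennreal (s\<^sup>2) * ?f x"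
    proof eventually_elim
      case (elim x)
      let ?I = "indicator (cball a (2 * r)) x :: real"
      have "(?\<eta> x)\<^sup>2 \<le> ?I"
        using cutoff_bounds[of a r "2 * r" x] cutoff_eq_0[OF r2, of x a]
        by (cases "x \<in> cball a (2 * r)") (auto intro: power_le_one)
      then have "(2 * s\<^sup>2 * grad_sq u x) * (?\<eta> x)\<^sup>2 \<le> (2 * s\<^sup>2 * grad_sq u x) * ?I"
        by (intro mult_left_mono) (auto simp: grad_sq_nonneg)
      with elim have "grad_sq v x \<le> s\<^sup>2 * ((2 * grad_sq u x + 2 * (CARD('n) * (1 / r)\<^sup>2) * (u x - u a)\<^sup>2) * ?I)"
        by (simp add: power_mult_distrib algebra_simps)
      then have "ennreal (grad_sq v x) \<le> ennreal (s\<^sup>2 * ((2 * grad_sq u x + 2 * (CARD('n) * (1 / r)\<^sup>2) * (u x - u a)\<^sup>2) * ?I))"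
        by (rule ennreal_leI)
      also have "\<dots> = ennreal (s\<^sup>2) * ?f x"
        by (simp add: ennreal_mult grad_sq_nonneg ennreal_indicator[symmetric] del: ennreal_indicator)
      finally show ?case .
    qed
  qed
  also have "\<dots> = ennreal (s\<^sup>2) * (\<integral>\<^sup>+ x. ?f x \<partial>lborel)"
    by (rule nn_integral_cmult) measurable
  finally have "ennreal \<kappa> \<le> ennreal (s\<^sup>2) * (\<integral>\<^sup>+ x. ?f x \<partial>lborel)"
    using \<kappa>(2) cap by (meson order_trans)
  then have "ennreal ((u a - 1)\<^sup>2) * ennreal \<kappa> \<le> ennreal ((u a - 1)\<^sup>2) * (ennreal (s\<^sup>2) * (\<integral>\<^sup>+ x. ?f x \<partial>lborel))"
    by (rule mult_left_mono) simp
  moreover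
  have "(u a - 1)\<^sup>2 * s\<^sup>2 = 1"
    using False by (simp add: s_def power_divide power2_commute)
  then have "ennreal ((u a - 1)\<^sup>2) * (ennreal (s\<^sup>2) * X) = X" for X
    by (simp add: mult.assoc[symmetric] ennreal_mult''[symmetric])
  ultimately have "ennreal ((u a - 1)\<^sup>2) * ennreal \<kappa> \<le> (\<integral>\<^sup>+ x. ?f x \<partial>lborel)" by simp
  moreover have "ennreal ((u a - 1)\<^sup>2) * ennreal \<kappa> = ennreal (\<kappa> * (u a - 1)\<^sup>2)"
    using \<kappa>(1) by (subst ennreal_mult) (auto simp: mult.commute)
  ultimately show ?thesis by simp
qed simp

text \<open>Integrate \<open>capacity_pointwise_bound\<close> over \<open>a \<in> A\<close>. After
  exchanging the integrals, each displacement \<open>h\<close> of length at most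
  \<open>2 * r\<close> contributes a multiple of the energy, and the measure of
  \<open>cball 0 (2 * r)\<close> counts the displacements.\<close>

lemma capacity_Poincare:
  fixes u :: "real ^ 'n \<Rightarrow> real"
  assumes u: "u \<in> cap_admissible F" and r: "0 < r" and [measurable]: "A \<in> sets borel"
    and \<kappa>: "0 \<le> \<kappa>" "\<And>a. a \<in> A \<Longrightarrow> ennreal \<kappa> \<le> wiener_cap (F \<inter> cball a r)"
  shows "ennreal \<kappa> * (\<integral>\<^sup>+ a. ennreal ((u a - 1)\<^sup>2) * indicator A a \<partial>lborel)
    \<le> ennreal ((2 + 2 * (CARD('n) * (1 / r)\<^sup>2) * (4 ^ CARD('n) * (2 * r)\<^sup>2)) * measure lborel (cball (0::real^'n) (2 * r)))
      * dirichlet_energy u"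
proof -
  obtain L where L: "L-lipschitz_on UNIV u" and bd: "bounded {x. u x \<noteq> 0}"
    using u by (auto simp: mem_cap_admissible)
  obtain B where B: "\<And>x. u x \<noteq> 0 \<Longrightarrow> norm x \<le> B" using bd by (auto simp: bounded_iff)
  have [measurable]: "u \<in> borel_measurable borel" by (rule borel_measurable_lipschitz[OF L])
  have [measurable]: "cball (0::real^'n) (2 * r) \<in> sets borel" by simp
  let ?E = "dirichlet_energy u" and ?c = "2 * (CARD('n) * (1 / r)\<^sup>2)" and ?\<rho> = "4 ^ CARD('n) * (2 * r)\<^sup>2"
  let ?I = "\<lambda>h. indicator (cball (0::real^'n) (2 * r)) h :: ennreal"
  have [measurable]: "grad_sq u \<in> borel_measurable borel" "?I \<in> borel_measurable borel" by measurable
  have "ennreal \<kappa> * (\<integral>\<^sup>+ a. ennreal ((u a - 1)\<^sup>2) * indicator A a \<partial>lborel)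
      = (\<integral>\<^sup>+ a. ennreal (\<kappa> * (u a - 1)\<^sup>2) * indicator A a \<partial>lborel)"
    using \<kappa>(1) by (subst nn_integral_cmult[symmetric]) (auto simp: ennreal_mult mult.assoc)
  \<comment> \<open>Substituting \<open>x = a + h\<close> makes the inner domain independent of
    \<open>a\<close>; on the right, \<open>a\<close> may then range over the whole space.\<close>
  also have "\<dots> \<le> (\<integral>\<^sup>+ a. (\<integral>\<^sup>+ h. ennreal (2 * grad_sq u (a + h) + ?c * (u (a + h) - u a)\<^sup>2) * ?I h \<partial>lborel) \<partial>lborel)"
  proof (rule nn_integral_mono)
    fix a
    show "ennreal (\<kappa> * (u a - 1)\<^sup>2) * indicator A a
        \<le> (\<integral>\<^sup>+ h. ennreal (2 * grad_sq u (a + h) + ?c * (u (a + h) - u a)\<^sup>2) * ?I h \<partial>lborel)"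
    proof (cases "a \<in> A")
      case True
      have "ennreal (\<kappa> * (u a - 1)\<^sup>2) \<le> (\<integral>\<^sup>+ x. ennreal (2 * grad_sq u x + ?c * (u x - u a)\<^sup>2) * indicator (cball a (2 * r)) x \<partial>lborel)"
        by (rule capacity_pointwise_bound[OF u r \<kappa>(1) \<kappa>(2)[OF True]])
      also have "\<dots> = (\<integral>\<^sup>+ h. ennreal (2 * grad_sq u (h + a) + ?c * (u (h + a) - u a)\<^sup>2) * indicator (cball a (2 * r)) (h + a) \<partial>lborel)"
      proof (rule nn_integral_lborel_translate[symmetric])
        have [measurable]: "cball a (2 * r) \<in> sets borel" by simp
        show "(\<lambda>x. ennreal (2 * grad_sq u x + ?c * (u x - u a)\<^sup>2) * indicator (cball a (2 * r)) x) \<in> borel_measurable borel"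
          by measurable
      qed
      also have "\<dots> = (\<integral>\<^sup>+ h. ennreal (2 * grad_sq u (a + h) + ?c * (u (a + h) - u a)\<^sup>2) * ?I h \<partial>lborel)"
        by (intro nn_integral_cong) (auto simp: indicator_def dist_norm add.commute)
      finally show ?thesis using True by simp
    qed simp
  qed
  also have "\<dots> = (\<integral>\<^sup>+ h. (\<integral>\<^sup>+ a. ennreal (2 * grad_sq u (a + h) + ?c * (u (a + h) - u a)\<^sup>2) * ?I h \<partial>lborel) \<partial>lborel)"
    by (rule lborel_pair.Fubini'[symmetric]) measurable
  \<comment> \<open>For fixed \<open>h\<close>, the gradient term integrates to the energy by
    translation invariance, and the other term is \<open>shift_energy u h\<close>, bounded with
    \<open>\<rho> = 2 * r\<close>.\<close>
  also have "\<dots> \<le> (\<integral>\<^sup>+ h. ennreal (2 + ?c * ?\<rho>) * ?E * ?I h \<partial>lborel)"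
  proof (rule nn_integral_mono)
    fix h
    show "(\<integral>\<^sup>+ a. ennreal (2 * grad_sq u (a + h) + ?c * (u (a + h) - u a)\<^sup>2) * ?I h \<partial>lborel) \<le> ennreal (2 + ?c * ?\<rho>) * ?E * ?I h"
    proof (cases "h \<in> cball 0 (2 * r)")
      case True
      have "(\<integral>\<^sup>+ a. ennreal (2 * grad_sq u (a + h) + ?c * (u (a + h) - u a)\<^sup>2) \<partial>lborel)
         = (\<integral>\<^sup>+ a. 2 * ennreal (grad_sq u (a + h)) + ennreal ?c * ennreal ((u (a + h) - u a)\<^sup>2) \<partial>lborel)"
        by (simp add: ennreal_plus ennreal_mult grad_sq_nonneg)
      also have "\<dots> = 2 * (\<integral>\<^sup>+ a. ennreal (grad_sq u (a + h)) \<partial>lborel) + ennreal ?c * shift_energy u h"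
        unfolding shift_energy_def by (simp add: nn_integral_add nn_integral_cmult)
      also have "(\<integral>\<^sup>+ a. ennreal (grad_sq u (a + h)) \<partial>lborel) = ?E"
        unfolding dirichlet_energy_eq[OF L] by (rule nn_integral_lborel_translate) measurable
      also have "2 * ?E + ennreal ?c * shift_energy u h \<le> 2 * ?E + ennreal ?c * (ennreal ?\<rho> * ?E)"
        using True by (intro add_left_mono mult_left_mono shift_energy_le_dirichlet[OF L B]) auto
      also have "\<dots> = ennreal (2 + ?c * ?\<rho>) * ?E"
      proof -
        have "2 * ?E + ennreal p * (ennreal q * ?E) = ennreal (2 + p * q) * ?E" if "0 \<le> p" "0 \<le> q" for p q
          using that by (simp add: ennreal_plus ennreal_mult distrib_right mult.assoc)
        then show ?thesis by simp
      qed
      finally show ?thesis using True by simp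
    qed simp
  qed
  also have "\<dots> = ennreal (2 + ?c * ?\<rho>) * ?E * emeasure lborel (cball (0::real^'n) (2 * r))"
    by (rule nn_integral_cmult_indicator) simp
  also have "emeasure lborel (cball (0::real^'n) (2 * r)) = ennreal (measure lborel (cball (0::real^'n) (2 * r)))"
    using emeasure_bounded_finite[of "cball (0::real^'n) (2 * r)"] by (simp add: emeasure_eq_ennreal_measure top.not_eq_extremum)
  finally show ?thesis by (simp add: ennreal_mult mult_ac)
qed

text \<open>For a test function \<open>u\<close> of \<open>F\<close>, the function
  \<open>u + \<eta> * (1 - u)\<close> equals 1 on the inner ball. Its energy is at most
  \<open>1 + \<epsilon>\<close> times that of \<open>u\<close> plus a multiple of the integral of
  \<open>(u - 1)\<^sup>2\<close> over the outer ball, which \<open>capacity_Poincare\<close> bounds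
  by the energy of \<open>u\<close>.\<close>

lemma wiener_cap_cball_le:
  fixes z :: "real ^ 'n"
  assumes r: "0 < r" and \<kappa>: "0 < \<kappa>"
    and \<rho>: "0 < \<rho>\<^sub>1" "\<rho>\<^sub>1 < \<rho>\<^sub>2" and \<epsilon>: "0 < \<epsilon>"
    and F: "\<And>a. a \<in> cball z \<rho>\<^sub>2 \<Longrightarrow> ennreal \<kappa> \<le> wiener_cap (F \<inter> cball a r)"
  shows "wiener_cap (cball z \<rho>\<^sub>1) \<le> ennreal (1 + \<epsilon> + (1 + 1 / \<epsilon>) * CARD('n) * (1 / (\<rho>\<^sub>2 - \<rho>\<^sub>1))\<^sup>2
      * ((2 + 2 * (CARD('n) * (1 / r)\<^sup>2) * (4 ^ CARD('n) * (2 * r)\<^sup>2)) * measure lborel (cball (0::real^'n) (2 * r)) / \<kappa>))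
    * wiener_cap F" (is "_ \<le> ennreal (1 + \<epsilon> + ?N * (?C / \<kappa>)) * _")
proof -
  let ?M = "1 + \<epsilon> + ?N * (?C / \<kappa>)" and ?K = "1 / (\<rho>\<^sub>2 - \<rho>\<^sub>1)"
  have N: "0 \<le> ?N" using \<epsilon> by simp
  have "0 \<le> ?C" by simp
  then have C: "0 \<le> ?C / \<kappa>" using \<kappa> by simp
  have M: "0 < ?M" using mult_nonneg_nonneg[OF N C] \<epsilon> by linarith
  have *: "wiener_cap (cball z \<rho>\<^sub>1) \<le> ennreal ?M * dirichlet_energy u" if u: "u \<in> cap_admissible F" for u
  proof -
    obtain L where L: "L-lipschitz_on UNIV u" and bd: "bounded {x. u x \<noteq> 0}"
      using u by (auto simp: mem_cap_admissible)
    have [measurable]: "u \<in> borel_measurable borel" "cball z \<rho>\<^sub>2 \<in> sets borel"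
      "grad_sq u \<in> borel_measurable borel"
      by (auto intro: borel_measurable_lipschitz[OF L] borel_measurable_grad_sq)
    let ?E = "dirichlet_energy u" and ?J = "\<integral>\<^sup>+ x. ennreal ((u x - 1)\<^sup>2) * indicator (cball z \<rho>\<^sub>2) x \<partial>lborel"
    let ?\<eta> = "cutoff z \<rho>\<^sub>1 \<rho>\<^sub>2"
    have "ennreal \<kappa> * ?J \<le> ennreal ?C * ?E"
      using \<kappa> by (intro capacity_Poincare[OF u r] F) auto
    then have "ennreal (1 / \<kappa>) * (ennreal \<kappa> * ?J) \<le> ennreal (1 / \<kappa>) * (ennreal ?C * ?E)"
      by (rule mult_left_mono) simp
    also have "ennreal (1 / \<kappa>) * (ennreal \<kappa> * ?J) = ?J"
      using \<kappa> by (simp add: mult.assoc[symmetric] ennreal_mult''[symmetric])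
    also have "ennreal (1 / \<kappa>) * (ennreal ?C * ?E) = ennreal (?C / \<kappa>) * ?E"
    proof -
      have "ennreal (1 / \<kappa>) * (ennreal c * X) = ennreal (c / \<kappa>) * X" if "0 \<le> c" for c X
        using \<kappa> that by (simp add: mult.assoc[symmetric] ennreal_mult[symmetric])
      then show ?thesis using \<open>0 \<le> ?C\<close> by blast
    qed
    finally have J: "?J \<le> ennreal (?C / \<kappa>) * ?E" .
    define v where "v = (\<lambda>x. 1 * u x + (- 1) * (?\<eta> x * (u x - 1)))"
    have "v \<in> cap_admissible (cball z \<rho>\<^sub>1)"
      unfolding v_def
      by (rule cap_admissible_cutoff[OF L bd lipschitz_cutoff[OF \<rho>(2)] cutoff_bounds cutoff_eq_0[OF \<rho>(2)]])
        (simp_all add: cutoff_eq_1[OF \<rho>(2)])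
    then obtain Lv where Lv: "Lv-lipschitz_on UNIV v" and cap: "wiener_cap (cball z \<rho>\<^sub>1) \<le> dirichlet_energy v"
      using wiener_cap_le by (auto simp: mem_cap_admissible)
    have "dirichlet_energy v = (\<integral>\<^sup>+ x. ennreal (grad_sq v x) \<partial>lborel)" by (rule dirichlet_energy_eq[OF Lv])
    also have "\<dots> \<le> (\<integral>\<^sup>+ x. ennreal (1 + \<epsilon>) * ennreal (grad_sq u x) + ennreal ?N * (ennreal ((u x - 1)\<^sup>2) * indicator (cball z \<rho>\<^sub>2) x) \<partial>lborel)"
    proof (rule nn_integral_mono_AE)
      have "AE x in lborel. grad_sq v x \<le> (1 + \<epsilon>) * (1 + - 1 * ?\<eta> x)\<^sup>2 * grad_sq u x
         + (1 + 1 / \<epsilon>) * ((- 1 :: real)\<^sup>2 * CARD('n) * ?K\<^sup>2) * ((u x - 1)\<^sup>2 * indicator (cball z \<rho>\<^sub>2) x)"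
        unfolding v_def by (rule grad_sq_cutoff_AE[OF L lipschitz_cutoff[OF \<rho>(2)] cutoff_eq_0[OF \<rho>(2)] \<epsilon>])
      then show "AE x in lborel. ennreal (grad_sq v x)
          \<le> ennreal (1 + \<epsilon>) * ennreal (grad_sq u x) + ennreal ?N * (ennreal ((u x - 1)\<^sup>2) * indicator (cball z \<rho>\<^sub>2) x)"
      proof eventually_elim
        case (elim x)
        let ?I = "indicator (cball z \<rho>\<^sub>2) x :: real"
        have "(1 + - 1 * ?\<eta> x)\<^sup>2 \<le> 1"
          using cutoff_bounds[of z \<rho>\<^sub>1 \<rho>\<^sub>2 x] by (intro power_le_one) auto
        then have "((1 + \<epsilon>) * grad_sq u x) * (1 + - 1 * ?\<eta> x)\<^sup>2 \<le> ((1 + \<epsilon>) * grad_sq u x) * 1"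
          using \<epsilon> grad_sq_nonneg[of u x] by (intro mult_left_mono) auto
        with elim have "grad_sq v x \<le> (1 + \<epsilon>) * grad_sq u x + ?N * ((u x - 1)\<^sup>2 * ?I)"
          by (simp add: mult_ac)
        then have "ennreal (grad_sq v x) \<le> ennreal ((1 + \<epsilon>) * grad_sq u x + ?N * ((u x - 1)\<^sup>2 * ?I))"
          by (rule ennreal_leI)
        also have "\<dots> = ennreal ((1 + \<epsilon>) * grad_sq u x) + ennreal (?N * ((u x - 1)\<^sup>2 * ?I))"
          using \<epsilon> N grad_sq_nonneg[of u x] by (intro ennreal_plus mult_nonneg_nonneg) auto
        also have "ennreal ((1 + \<epsilon>) * grad_sq u x) = ennreal (1 + \<epsilon>) * ennreal (grad_sq u x)"
          using \<epsilon> grad_sq_nonneg[of u x] by (intro ennreal_mult) auto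
        also have "ennreal (?N * ((u x - 1)\<^sup>2 * ?I)) = ennreal ?N * ennreal ((u x - 1)\<^sup>2 * ?I)"
          using N by (intro ennreal_mult) auto
        also have "ennreal ((u x - 1)\<^sup>2 * ?I) = ennreal ((u x - 1)\<^sup>2) * indicator (cball z \<rho>\<^sub>2) x"
          by (simp add: indicator_def)
        finally show ?case .
      qed
    qed
    also have "\<dots> = ennreal (1 + \<epsilon>) * ?E + ennreal ?N * ?J"
      by (simp add: nn_integral_add nn_integral_cmult dirichlet_energy_eq[OF L])
    also have "\<dots> \<le> ennreal (1 + \<epsilon>) * ?E + ennreal ?N * (ennreal (?C / \<kappa>) * ?E)"
      by (intro add_left_mono mult_left_mono J) simp
    also have "\<dots> = (ennreal (1 + \<epsilon>) + ennreal ?N * ennreal (?C / \<kappa>)) * ?E"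
      by (simp only: distrib_right mult.assoc)
    also have "ennreal (1 + \<epsilon>) + ennreal ?N * ennreal (?C / \<kappa>) = ennreal ?M"
    proof -
      have "ennreal (1 + \<epsilon>) + ennreal p * ennreal q = ennreal (1 + \<epsilon> + p * q)" if "0 \<le> p" "0 \<le> q" for p q
        using \<epsilon> that by (subst ennreal_plus) (auto simp: ennreal_mult)
      then show ?thesis using N C by blast
    qed
    finally show ?thesis using cap by (rule order_trans[rotated])
  qed
  have inv: "ennreal (1 / ?M) * (ennreal ?M * X) = X" "ennreal ?M * (ennreal (1 / ?M) * X) = X" for X
  proof -
    have inv: "ennreal (1 / m) * (ennreal m * X) = X" "ennreal m * (ennreal (1 / m) * X) = X" if "0 < m" for m
      using that by (simp_all add: mult.assoc[symmetric] ennreal_mult''[symmetric])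
    show "ennreal (1 / ?M) * (ennreal ?M * X) = X" "ennreal ?M * (ennreal (1 / ?M) * X) = X"
      by (rule inv[OF M])+
  qed
  \<comment> \<open>The positive finite constant is moved to the left before the infimum over
    \<open>u\<close> is taken, and moved back afterwards.\<close>
  have "ennreal (1 / ?M) * wiener_cap (cball z \<rho>\<^sub>1) \<le> wiener_cap F"
  proof (rule wiener_cap_greatest)
    fix u :: "real ^ 'n \<Rightarrow> real" assume "u \<in> cap_admissible F"
    from mult_left_mono[OF *[OF this], of "ennreal (1 / ?M)"]
    show "ennreal (1 / ?M) * wiener_cap (cball z \<rho>\<^sub>1) \<le> dirichlet_energy u" by (simp only: inv zero_le)
  qed
  from mult_left_mono[OF this, of "ennreal ?M"] show ?thesis by (simp only: inv zero_le)
qed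

section \<open>Passing from one threshold to the other\<close>

lemma wiener_cap_cball_center:
  fixes a b :: "real ^ 'n"
  assumes "2 \<le> CARD('n)"
  shows "wiener_cap (cball a r) = wiener_cap (cball b r)"
  using wiener_cap_homothety[OF zero_less_one assms, of a r b] wiener_cap_homothety[OF zero_less_one assms, of b r a]
  by (simp add: antisym)

text \<open>With \<open>\<theta> = 1 - s\<close> and \<open>\<epsilon> = s\<close>, the two sides
  tend to \<open>\<gamma>\<close> and 1 as \<open>s\<close> decreases to 0.\<close>

lemma less_power_margin:
  fixes \<gamma> :: real
  assumes "0 < \<gamma>" "\<gamma> < 1"
  obtains \<theta> \<epsilon> where "0 < \<theta>" "\<theta> < 1" "0 < \<epsilon>" "\<gamma> * (1 + \<epsilon>) < \<theta> ^ m"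
proof -
  have "((\<lambda>s. (1 - s) ^ m - \<gamma> * (1 + s)) \<longlongrightarrow> (1 - 0) ^ m - \<gamma> * (1 + 0)) (at_right (0::real))"
    by (intro tendsto_intros)
  then have "\<forall>\<^sub>F s in at_right 0. (1 - s) ^ m - \<gamma> * (1 + s) > 0"
    by (rule order_tendstoD(1)) (use assms in simp)
  moreover have "\<forall>\<^sub>F s in at_right (0::real). s < 1"
    by (rule order_tendstoD(2)[OF tendsto_ident_at]) simp
  moreover have "\<forall>\<^sub>F s in at_right (0::real). 0 < s"
    by (rule eventually_at_right_less)
  ultimately have "\<forall>\<^sub>F s in at_right (0::real). 0 < s \<and> s < 1 \<and> \<gamma> * (1 + s) < (1 - s) ^ m"
    by eventually_elim auto
  then obtain s :: real where "0 < s" "s < 1" "\<gamma> * (1 + s) < (1 - s) ^ m"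
    using eventually_happens[of _ "at_right (0::real)"] by (auto simp: trivial_limit_at_right_real)
  then show thesis using that[of "1 - s" s] by simp
qed

lemma interior_cap_radius_finite_transfer:
  fixes \<Omega> :: "(real ^ 'n) set"
  assumes n: "2 \<le> CARD('n)" and \<Omega>: "open \<Omega>"
    and \<gamma>\<^sub>1: "0 < \<gamma>\<^sub>1" and \<gamma>\<^sub>2: "0 < \<gamma>\<^sub>2" "\<gamma>\<^sub>2 < 1"
    and fin: "interior_cap_radius \<Omega> \<gamma>\<^sub>1 < \<infinity>"
  shows "interior_cap_radius \<Omega> \<gamma>\<^sub>2 < \<infinity>"
proof -
  \<comment> \<open>The capacity of a ball as a real function of the radius alone; it is finite by
    the cutoff and independent of the center by translation.\<close>
  define cp where "cp = (\<lambda>R. enn2real (wiener_cap (cball (0::real^'n) R)))"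
  have cp: "wiener_cap (cball a R) = ennreal (cp R)" if "0 < R" for a :: "real^'n" and R
    unfolding wiener_cap_cball_center[OF n, of a R 0] cp_def
    using wiener_cap_cball_finite[OF that, of "0::real^'n"] by simp
  have cp0: "0 \<le> cp R" for R by (simp add: cp_def)
  have neg: "cap_negligible \<gamma> a R (cball a R - \<Omega>) \<longleftrightarrow> wiener_cap (cball a R - \<Omega>) \<le> ennreal \<gamma> * wiener_cap (cball a R)" for \<gamma> a R
    using compact_diff[OF compact_cball \<Omega>] by (auto simp: cap_negligible_def)
  obtain s where s: "0 \<le> s" "interior_cap_radius \<Omega> \<gamma>\<^sub>1 = ennreal s"
    using fin by (cases "interior_cap_radius \<Omega> \<gamma>\<^sub>1") auto
  \<comment> \<open>This radius exceeds the supremum for \<open>\<gamma>\<^sub>1\<close>, so no ball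
    of radius \<open>r\<close> is negligible. That gives the lower bound \<open>big\<close>, uniform
    in the center.\<close>
  define r where "r = s + 1"
  have r: "0 < r" using s by (simp add: r_def)
  have big: "ennreal (\<gamma>\<^sub>1 * cp r) < wiener_cap (cball a r - \<Omega>)" for a
  proof (rule ccontr)
    assume "\<not> ennreal (\<gamma>\<^sub>1 * cp r) < wiener_cap (cball a r - \<Omega>)"
    then have "cap_negligible \<gamma>\<^sub>1 a r (cball a r - \<Omega>)"
      using \<gamma>\<^sub>1 by (simp add: neg cp[OF r] not_less ennreal_mult cp0)
    then have "ennreal r \<le> interior_cap_radius \<Omega> \<gamma>\<^sub>1"
      unfolding interior_cap_radius_def using r by (intro Sup_upper) auto
    then show False using s by (simp add: r_def)
  qed
  \<comment> \<open>Positivity comes from the strictness of \<open>big\<close>: with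
    \<open>cp r = 0\<close>, monotonicity of capacity would give \<open>0 < 0\<close>. Scaling then
    carries it to every radius in \<open>cpp\<close>.\<close>
  have cpr: "0 < cp r"
  proof -
    have "wiener_cap (cball 0 r - \<Omega>) \<le> wiener_cap (cball (0::real^'n) r)" by (intro wiener_cap_mono) auto
    then have "ennreal (\<gamma>\<^sub>1 * cp r) < ennreal (cp r)" using big[of 0] by (simp add: cp[OF r])
    then have "cp r \<noteq> 0" by auto
    then show ?thesis using cp0[of r] by simp
  qed
  have cpp: "0 < cp R" if "0 < R" for R
  proof -
    have "ennreal ((R / r) ^ (CARD('n) - 2)) * wiener_cap (cball (0::real^'n) r) \<le> wiener_cap (cball (0::real^'n) (R / r * r))"
      using that r by (intro wiener_cap_homothety n) auto
    then have "ennreal ((R / r) ^ (CARD('n) - 2) * cp r) \<le> ennreal (cp R)"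
      using that r by (simp add: cp ennreal_mult cp0)
    moreover have "0 < (R / r) ^ (CARD('n) - 2) * cp r" using that r cpr by simp
    ultimately show ?thesis using cp0[of R] by (simp add: ennreal_le_iff)
  qed
  define \<kappa> where "\<kappa> = \<gamma>\<^sub>1 * cp r"
  have \<kappa>: "0 < \<kappa>" using \<gamma>\<^sub>1 cpr by (simp add: \<kappa>_def)
  let ?m = "CARD('n) - 2"
  obtain \<theta> \<epsilon> where \<theta>: "0 < \<theta>" "\<theta> < 1" and \<epsilon>: "0 < \<epsilon>" and m: "\<gamma>\<^sub>2 * (1 + \<epsilon>) < \<theta> ^ ?m"
    using less_power_margin[OF \<gamma>\<^sub>2] by blast
  \<comment> \<open>The width \<open>(1 - \<theta>) * R\<close> is split in two equal margins: one
    for the cutoff, from \<open>\<theta> * R\<close> to \<open>(\<theta> + \<delta>) * R\<close>,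
    and one to keep balls of radius \<open>r\<close> about points of
    \<open>cball z ((\<theta> + \<delta>) * R)\<close> inside \<open>cball z R\<close>.\<close>
  define \<delta> where "\<delta> = (1 - \<theta>) / 2"
  have \<delta>: "0 < \<delta>" "\<theta> + \<delta> + \<delta> = 1" using \<theta> by (auto simp: \<delta>_def)
  define D where "D = (2 + 2 * (CARD('n) * (1 / r)\<^sup>2) * (4 ^ CARD('n) * (2 * r)\<^sup>2)) * measure lborel (cball (0::real^'n) (2 * r)) / \<kappa>"
  \<comment> \<open>The constant of \<open>wiener_cap_cball_le\<close> for a cutoff of width
    \<open>\<delta> * R\<close>; \<open>D\<close> collects what does not depend on
    \<open>R\<close>.\<close>
  define M where "M = (\<lambda>R. 1 + \<epsilon> + (1 + 1 / \<epsilon>) * CARD('n) * (1 / (\<delta> * R))\<^sup>2 * D)"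
  have "D \<ge> 0" using \<kappa> by (simp add: D_def)
  then have M0: "0 \<le> M R" for R using \<epsilon> by (auto simp: M_def intro!: add_nonneg_nonneg mult_nonneg_nonneg)
  have bound: "\<theta> ^ ?m \<le> M R * \<gamma>\<^sub>2" if R: "r / \<delta> \<le> R" and negl: "cap_negligible \<gamma>\<^sub>2 z R (cball z R - \<Omega>)" for z R
  proof -
    have rR: "r \<le> \<delta> * R" using R \<delta> by (simp add: field_simps)
    have R0: "0 < R" using R r \<delta> by (meson divide_pos_pos less_le_trans)
    let ?F = "cball z R - \<Omega>"
    have \<rho>: "\<theta> * R < (\<theta> + \<delta>) * R" "(\<theta> + \<delta>) * R - \<theta> * R = \<delta> * R" using \<delta> R0 by (auto simp: algebra_simps)
    have "ennreal \<kappa> \<le> wiener_cap (?F \<inter> cball a r)" if a: "a \<in> cball z ((\<theta> + \<delta>) * R)" for a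
    proof -
      have "(\<theta> + \<delta>) * R + r \<le> (\<theta> + \<delta> + \<delta>) * R" using rR by (simp add: algebra_simps)
      then have "(\<theta> + \<delta>) * R + r \<le> R" using \<delta> by simp
      then have "cball a r \<subseteq> cball z R"
        using a by (intro subsetI) (smt (verit) dist_triangle mem_cball)
      then have "?F \<inter> cball a r = cball a r - \<Omega>" by blast
      then show ?thesis using big[of a] by (simp add: \<kappa>_def less_imp_le)
    qed
    then have "wiener_cap (cball z (\<theta> * R)) \<le> ennreal (M R) * wiener_cap ?F"
      using wiener_cap_cball_le[OF r \<kappa> _ \<rho>(1) \<epsilon>, of z ?F] \<theta> R0 unfolding \<rho>(2) M_def D_def by simp
    also have "\<dots> \<le> ennreal (M R) * (ennreal \<gamma>\<^sub>2 * ennreal (cp R))"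
      using negl by (intro mult_left_mono) (auto simp: neg cp[OF R0])
    also have "\<dots> = ennreal (M R * \<gamma>\<^sub>2 * cp R)"
      using \<gamma>\<^sub>2 cp0 M0 by (simp add: ennreal_mult mult.assoc)
    finally have "wiener_cap (cball z (\<theta> * R)) \<le> ennreal (M R * \<gamma>\<^sub>2 * cp R)" .
    moreover have "ennreal (\<theta> ^ ?m) * wiener_cap (cball z R) \<le> wiener_cap (cball z (\<theta> * R))"
      by (rule wiener_cap_homothety[OF \<theta>(1) n])
    ultimately have "ennreal (\<theta> ^ ?m * cp R) \<le> ennreal (M R * \<gamma>\<^sub>2 * cp R)"
      using \<theta> cp0 by (auto simp: cp[OF R0] ennreal_mult'' intro: order_trans)
    then have "\<theta> ^ ?m * cp R \<le> M R * \<gamma>\<^sub>2 * cp R"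
      using M0 \<gamma>\<^sub>2 cp0 by (subst (asm) ennreal_le_iff) auto
    then show ?thesis using cpp[OF R0] by simp
  qed
  \<comment> \<open>The term with \<open>D\<close> decays like \<open>1 / R\<^sup>2\<close>, so
    \<open>M R * \<gamma>\<^sub>2\<close> tends to
    \<open>(1 + \<epsilon>) * \<gamma>\<^sub>2\<close>, which lies below
    \<open>\<theta> ^ ?m\<close> by the choice of \<open>\<theta>\<close> and
    \<open>\<epsilon>\<close>.\<close>
  have "(M \<longlongrightarrow> 1 + \<epsilon> + (1 + 1 / \<epsilon>) * CARD('n) * 0\<^sup>2 * D) at_top"
    unfolding M_def using \<delta>
    by (intro tendsto_intros tendsto_divide_0[OF tendsto_const] filterlim_at_top_imp_at_infinity
      filterlim_tendsto_pos_mult_at_top[OF tendsto_const] filterlim_ident) auto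
  then have "((\<lambda>R. M R * \<gamma>\<^sub>2) \<longlongrightarrow> (1 + \<epsilon>) * \<gamma>\<^sub>2) at_top"
    by (intro tendsto_mult_right) simp
  then have "\<forall>\<^sub>F R in at_top. M R * \<gamma>\<^sub>2 < \<theta> ^ ?m"
    using m by (intro order_tendstoD(2)) (auto simp: mult.commute)
  then obtain R\<^sub>0 where R\<^sub>0: "\<And>R. R\<^sub>0 \<le> R \<Longrightarrow> M R * \<gamma>\<^sub>2 < \<theta> ^ ?m"
    by (auto simp: eventually_at_top_linorder)
  have "interior_cap_radius \<Omega> \<gamma>\<^sub>2 \<le> ennreal (max R\<^sub>0 (r / \<delta>))"
    unfolding interior_cap_radius_def
  proof (rule Sup_least)
    fix y assume "y \<in> {ennreal r |r. 0 < r \<and> (\<exists>a. cap_negligible \<gamma>\<^sub>2 a r (cball a r - \<Omega>))}"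
    then obtain R z where y: "y = ennreal R" "cap_negligible \<gamma>\<^sub>2 z R (cball z R - \<Omega>)" by auto
    \<comment> \<open>A negligible ball with radius above both numbers would satisfy
      \<open>bound\<close> and the opposite strict inequality from \<open>R\<^sub>0\<close>.\<close>
    have "R \<le> max R\<^sub>0 (r / \<delta>)" using bound[OF _ y(2)] R\<^sub>0[of R] by fastforce
    then show "y \<le> ennreal (max R\<^sub>0 (r / \<delta>))" unfolding y(1) by (rule ennreal_leI)
  qed
  also have "\<dots> < \<infinity>" by simp
  finally show ?thesis .
qed

theorem corollary1p3:
  fixes \<Omega> :: "(real ^ 'n) set" and \<gamma>\<^sub>1 \<gamma>\<^sub>2 :: real
  assumes "CARD('n) \<ge> 3"
    and "open \<Omega>"
    and "0 < \<gamma>\<^sub>1" "\<gamma>\<^sub>1 < 1"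
    and "0 < \<gamma>\<^sub>2" "\<gamma>\<^sub>2 < 1"
  shows "interior_cap_radius \<Omega> \<gamma>\<^sub>1 < \<infinity> \<longleftrightarrow> interior_cap_radius \<Omega> \<gamma>\<^sub>2 < \<infinity>"
proof -
  have n: "2 \<le> CARD('n)" using assms(1) by simp
  show ?thesis
    using interior_cap_radius_finite_transfer[OF n assms(2,3,5,6)]
      interior_cap_radius_finite_transfer[OF n assms(2,5,3,4)] by (rule iffI)
qed

end
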